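(* Consider the media agency problem with limited liability (with either the GSP or the VCG mechanism), under the assumption that there exists a bidding strategy $b^c\in[0,1]^{n_c}$ with $\tilde r_i(b^c)-\tilde\pi_i(b^c)\ge t_i$ for all $i\in N_c$, and let $OPT$ be its optimal value. Let $p\in(0,1]$. Then the linear program, over $q\in\mathbb{R}^{n_c}_{\ge0}$ and probability distributions $\gamma$ on $B^{c,p}$, $$\max_{q\ge0,\ \gamma\in\Delta_{B^{c,p}}}\ \sum_{b^c\in B^{c,p}}\gamma_{b^c}\sum_{i\in N_c}\bigl(\tilde r_i(b^c)-\tilde\pi_i(b^c)\bigr)$$ subject to $$\sum_{b^c\in B^{c,p}}\gamma_{b^c}\tilde r_i(b^c)-q_i\ge t_i-p\ \ \forall i\in N_c,\qquad \sum_{i\in N_c}q_i\ge\sum_{b^c\in B^{c,p}}\gamma_{b^c}\sum_{i\in N_c}\tilde\pi_i(b^c),$$ is feasible. Moreover, its optimal value is at least $OPT-p\,n_c$.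
   Context: Ad auction. There are colluders $N_c=\{1,\dots,n_c\}$ and external agents $N_e=\{1,\dots,n_e\}$, $n=n_c+n_e$ agents in total, and slots $\{1,\dots,m\}$, $m\le n$, with click-through rates $1\ge\lambda_1\ge\dots\ge\lambda_m\ge 0$; set $\lambda_k=0$ for $k>m$. Agent $i$ has valuation $v_i\in[0,1]$. A bidding strategy is a vector $b^c\in B^c:=[0,1]^{n_c}$ of colluders' bids; $b^e\in[0,1]^{n_e}$ is the vector of external bids. Given the full bid profile $b=(b^c,b^e)$, agents are ranked by decreasing bid, and the agent ranked $k$-th gets slot $k$ for $k\le m$ (agents ranked below $m$ get no slot). Ties between a colluder and an external agent are broken in favor of the colluder; ties among colluders are broken by index, with colluders indexed so that $v_1\ge\dots\ge v_{n_c}$. Write $b_{(k)}$ for the $k$-th highest bid ($b_{(n+1)}=0$). An agent $i$ ranked $k$-th has expected revenue $r_i(b)=\lambda_k v_i$, and expected payment - GSP mechanism: $\pi_i(b)=\lambda_k b_{(k+1)}$; - VCG mechanism: $\pi_i(b)=\sum_{j=k+1}^{m+1}b_{(j)}(\lambda_{j-1}-\lambda_j)$ if $k\le m$, and $0$ otherwise. The external profile $b^e$ is drawn from a probability distribution $\gamma^e$ in whose support all bids are representable with $M$ bits (i.e. are integer multiples of $2^{-M}$); $\tilde r_i(b^c)=\mathbb{E}_{b^e\sim\gamma^e}[r_i(b^c,b^e)]$ and $\tilde\pi_i(b^c)=\mathbb{E}_{b^e\sim\gamma^e}[\pi_i(b^c,b^e)]$. Media agency problem with limited liability. Given $t_i\in[0,1]$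 for $i\in N_c$, choose a probability distribution $\gamma$ over $B^c$ and transfers $q\in\mathbb{R}^{n_c}$ to maximize $\sum_{i\in N_c}\mathbb{E}_{b^c\sim\gamma}[\tilde r_i(b^c)-\tilde\pi_i(b^c)]$ subject to IC: $\mathbb{E}_{b^c\sim\gamma}[\tilde r_i(b^c)]-q_i\ge t_i$ for all $i\in N_c$; IR: $\sum_{i\in N_c}q_i\ge\sum_{i\in N_c}\mathbb{E}_{b^c\sim\gamma}[\tilde\pi_i(b^c)]$; and LL: $q_i\ge0$ for all $i\in N_c$. Discretized bids. For an interval $(\alpha,\beta]\subseteq[0,1]$, define recursively $\textsc{Rec}((\alpha,\beta],p,\eta)$: if $\mathbb{P}_{b^e\sim\gamma^e}\{\exists j\in N_e: b^e_j\in(\alpha,\beta]\}\le p$ or $\beta-\alpha\le\eta$, return $\{(\alpha,\beta]\}$; otherwise return $\textsc{Rec}((\alpha,\frac{\alpha+\beta}2],p,\eta)\cup\textsc{Rec}((\frac{\alpha+\beta}2,\beta],p,\eta)$. Let $\eta=2^{-M}$ and $I^{p,\eta}=\textsc{Rec}((0,1],p,\eta)$. The discretized bid values are $\alpha+\tau i$ for $(\alpha,\beta]\in I^{p,\eta}$ and $i\in N_c$, and $B^{c,p}$ is the set of bidding strategies all of whose components are discretized bid values; $\Delta_{B^{c,p}}$ is the set of probability distributions on this finite set. Here $\tau>0$ is arbitrarily small and serves only to induce tie-breaking; the loss it causes is ignored. That is, a bid $\alpha+\tau i$ has numerical value $\alpha$ in all payments, but is ranked above all bids (of external agents or others) less than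 or equal to $\alpha$, below all external bids greater than $\alpha$, and above a bid $\alpha+\tau i'$ whenever $i>i'$. *)

theory Defs
  imports "HOL-Probability.Probability"
begin

datatype mechanism = GSP | VCG

record auction =
  n_col :: nat                            (* colluders are 1..n_col *)
  n_ext :: nat                            (* external agents are 1..n_ext *)
  n_slots :: nat                          (* slots are 1..n_slots *)
  ctr :: "nat \<Rightarrow> real"                   (* lambda, extended by 0 beyond the last slot *)
  val :: "nat \<Rightarrow> real"                   (* valuations of the colluders *)
  bits :: nat                             (* M *)
  ext_dist :: "(nat \<Rightarrow> real) pmf"         (* gamma^e *)

definition ext_profiles :: "auction \<Rightarrow> (nat \<Rightarrow> real) set" where
  "ext_profiles A = {1..n_ext A} \<rightarrow>\<^sub>E {x. 0 \<le> x \<and> x \<le> 1 \<and> (\<exists>k::nat. x = real k / 2 ^ bits A)}"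

definition ad_auction :: "auction \<Rightarrow> bool" where
  "ad_auction A \<longleftrightarrow>
     n_slots A \<le> n_col A + n_ext A \<and>
     (\<forall>k\<in>{1..n_slots A}. 0 \<le> ctr A k \<and> ctr A k \<le> 1) \<and>
     (\<forall>k\<in>{1..<n_slots A}. ctr A (k + 1) \<le> ctr A k) \<and>
     (\<forall>k>n_slots A. ctr A k = 0) \<and>
     (\<forall>i\<in>{1..n_col A}. 0 \<le> val A i \<and> val A i \<le> 1) \<and>
     (\<forall>i\<in>{1..<n_col A}. val A (i + 1) \<le> val A i) \<and>
     set_pmf (ext_dist A) \<subseteq> ext_profiles A"

text \<open>
  A colluder's bid is a pair \<open>(x, s)\<close>, read as \<open>x + \<tau> s\<close> for an infinitesimal \<open>\<tau> > 0\<close>: its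
  numerical value in every payment is \<open>x\<close>, and \<open>s\<close> only orders colluders that bid the same
  value. An ordinary bid \<open>x\<close> is the pair \<open>(x, 0)\<close> (see \<open>plain\<close>). Remaining ties between
  colluders go to the smaller index, i.e. to the colluder with the larger valuation. The order
  of tied external agents does not affect the colluders; it is fixed by index.
\<close>

type_synonym strategy = "nat \<Rightarrow> real \<times> nat"

definition plain :: "(nat \<Rightarrow> real) \<Rightarrow> strategy" where
  "plain b = (\<lambda>i. (b i, 0))"

datatype agent = Colluder nat | External nat

definition agents :: "auction \<Rightarrow> agent list" where
  "agents A = map Colluder [1..<n_col A + 1] @ map External [1..<n_ext A + 1]"

fun bid :: "strategy \<Rightarrow> (nat \<Rightarrow> real) \<Rightarrow> agent \<Rightarrow> real" where
  "bid bc be (Colluder i) = fst (bc i)"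
| "bid bc be (External j) = be j"

fun ranked_above :: "strategy \<Rightarrow> (nat \<Rightarrow> real) \<Rightarrow> agent \<Rightarrow> agent \<Rightarrow> bool" where
  "ranked_above bc be (Colluder i) (Colluder i') \<longleftrightarrow>
     fst (bc i) > fst (bc i') \<or>
     fst (bc i) = fst (bc i') \<and> (snd (bc i) > snd (bc i') \<or> snd (bc i) = snd (bc i') \<and> i < i')"
| "ranked_above bc be (Colluder i) (External j) \<longleftrightarrow> fst (bc i) \<ge> be j"
| "ranked_above bc be (External j) (Colluder i) \<longleftrightarrow> be j > fst (bc i)"
| "ranked_above bc be (External j) (External j') \<longleftrightarrow> be j > be j' \<or> be j = be j' \<and> j < j'"

definition rank :: "auction \<Rightarrow> strategy \<Rightarrow> (nat \<Rightarrow> real) \<Rightarrow> agent \<Rightarrow> nat" where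
  "rank A bc be a = card {a' \<in> set (agents A). ranked_above bc be a' a} + 1"

definition kth_bid :: "auction \<Rightarrow> strategy \<Rightarrow> (nat \<Rightarrow> real) \<Rightarrow> nat \<Rightarrow> real" where
  "kth_bid A bc be k =
     (if 1 \<le> k \<and> k \<le> n_col A + n_ext A
      then rev (sort (map (bid bc be) (agents A))) ! (k - 1) else 0)"

definition revenue :: "auction \<Rightarrow> strategy \<Rightarrow> (nat \<Rightarrow> real) \<Rightarrow> nat \<Rightarrow> real" where
  "revenue A bc be i = ctr A (rank A bc be (Colluder i)) * val A i"

fun payment :: "mechanism \<Rightarrow> auction \<Rightarrow> strategy \<Rightarrow> (nat \<Rightarrow> real) \<Rightarrow> nat \<Rightarrow> real" where
  "payment GSP A bc be i =
     (let k = rank A bc be (Colluder i) in ctr A k * kth_bid A bc be (k + 1))"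
| "payment VCG A bc be i =
     (let k = rank A bc be (Colluder i) in
      if k \<le> n_slots A
      then \<Sum>j = k + 1..n_slots A + 1. kth_bid A bc be j * (ctr A (j - 1) - ctr A j)
      else 0)"

definition exp_revenue :: "auction \<Rightarrow> nat \<Rightarrow> strategy \<Rightarrow> real" where
  "exp_revenue A i bc = measure_pmf.expectation (ext_dist A) (\<lambda>be. revenue A bc be i)"

definition exp_payment :: "mechanism \<Rightarrow> auction \<Rightarrow> nat \<Rightarrow> strategy \<Rightarrow> real" where
  "exp_payment mech A i bc = measure_pmf.expectation (ext_dist A) (\<lambda>be. payment mech A bc be i)"


section \<open>The media agency problem with limited liability\<close>

definition bid_space :: "auction \<Rightarrow> (nat \<Rightarrow> real) measure" where
  "bid_space A = (\<Pi>\<^sub>M i\<in>{1..n_col A}. restrict_space borel {0..1})"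

definition ma_feasible ::
  "mechanism \<Rightarrow> auction \<Rightarrow> (nat \<Rightarrow> real) \<Rightarrow> (nat \<Rightarrow> real) measure \<Rightarrow> (nat \<Rightarrow> real) \<Rightarrow> bool" where
  "ma_feasible mech A t \<gamma> q \<longleftrightarrow>
     prob_space \<gamma> \<and> sets \<gamma> = sets (bid_space A) \<and>
     (\<forall>i\<in>{1..n_col A}. (LINT b|\<gamma>. exp_revenue A i (plain b)) - q i \<ge> t i) \<and>
     (\<Sum>i = 1..n_col A. q i) \<ge> (\<Sum>i = 1..n_col A. LINT b|\<gamma>. exp_payment mech A i (plain b)) \<and>
     (\<forall>i\<in>{1..n_col A}. q i \<ge> 0)"

definition ma_objective :: "mechanism \<Rightarrow> auction \<Rightarrow> (nat \<Rightarrow> real) measure \<Rightarrow> real" where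
  "ma_objective mech A \<gamma> =
     (\<Sum>i = 1..n_col A. LINT b|\<gamma>. exp_revenue A i (plain b) - exp_payment mech A i (plain b))"

definition ma_opt :: "mechanism \<Rightarrow> auction \<Rightarrow> (nat \<Rightarrow> real) \<Rightarrow> ereal" where
  "ma_opt mech A t = (SUP (\<gamma>, q) \<in> {(\<gamma>, q). ma_feasible mech A t \<gamma> q}. ereal (ma_objective mech A \<gamma>))"


section \<open>The discretized linear program\<close>

definition ext_prob :: "auction \<Rightarrow> real \<Rightarrow> real \<Rightarrow> real" where
  "ext_prob A \<alpha> \<beta> = measure_pmf.prob (ext_dist A) {be. \<exists>j\<in>{1..n_ext A}. be j \<in> {\<alpha><..\<beta>}}"

text \<open>The pair \<open>(\<alpha>, \<beta>)\<close> encodes the interval \<open>{\<alpha><..\<beta>}\<close>; the width threshold is fixed to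
  \<open>\<eta> = 1 / 2 ^ bits A\<close>.\<close>

function rec_intervals :: "auction \<Rightarrow> real \<Rightarrow> real \<Rightarrow> real \<Rightarrow> (real \<times> real) set" where
  "rec_intervals A p \<alpha> \<beta> =
     (if ext_prob A \<alpha> \<beta> \<le> p \<or> \<beta> - \<alpha> \<le> 1 / 2 ^ bits A then {(\<alpha>, \<beta>)}
      else rec_intervals A p \<alpha> ((\<alpha> + \<beta>) / 2) \<union> rec_intervals A p ((\<alpha> + \<beta>) / 2) \<beta>)"
  by pat_completeness auto
termination
proof (relation "Wellfounded.measure (\<lambda>(A :: auction, p :: real, \<alpha>, \<beta>). nat \<lceil>(\<beta> - \<alpha>) * 2 ^ bits A\<rceil>)")
  have halve: "nat \<lceil>x / 2\<rceil> < nat \<lceil>x\<rceil>" if "1 < x" for x :: real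
  proof -
    have "2 \<le> \<lceil>x\<rceil>"
      using that by linarith
    then have "x / 2 \<le> of_int (\<lceil>x\<rceil> - 1)"
      using le_of_int_ceiling [of x] by linarith
    then have "\<lceil>x / 2\<rceil> \<le> \<lceil>x\<rceil> - 1"
      by (simp only: ceiling_le_iff)
    with \<open>2 \<le> \<lceil>x\<rceil>\<close> show ?thesis
      by linarith
  qed
  have wide: "1 < (\<beta> - \<alpha>) * 2 ^ bits A"
    if "\<not> (ext_prob A \<alpha> \<beta> \<le> p \<or> \<beta> - \<alpha> \<le> 1 / 2 ^ bits A)" for A :: auction and p \<alpha> \<beta>
    using that by (simp add: field_simps)
  fix A :: auction and p \<alpha> \<beta> :: real
  assume c: "\<not> (ext_prob A \<alpha> \<beta> \<le> p \<or> \<beta> - \<alpha> \<le> 1 / 2 ^ bits A)"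
  have "((\<alpha> + \<beta>) / 2 - \<alpha>) * 2 ^ bits A = (\<beta> - \<alpha>) * 2 ^ bits A / 2"
    and "(\<beta> - (\<alpha> + \<beta>) / 2) * 2 ^ bits A = (\<beta> - \<alpha>) * 2 ^ bits A / 2"
    by (simp_all add: field_simps)
  then show "((A, p, \<alpha>, (\<alpha> + \<beta>) / 2), A, p, \<alpha>, \<beta>)
      \<in> Wellfounded.measure (\<lambda>(A :: auction, p :: real, \<alpha>, \<beta>). nat \<lceil>(\<beta> - \<alpha>) * 2 ^ bits A\<rceil>)"
    and "((A, p, (\<alpha> + \<beta>) / 2, \<beta>), A, p, \<alpha>, \<beta>)
      \<in> Wellfounded.measure (\<lambda>(A :: auction, p :: real, \<alpha>, \<beta>). nat \<lceil>(\<beta> - \<alpha>) * 2 ^ bits A\<rceil>)"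
    using halve [OF wide [OF c]] by (simp_all only: in_measure prod.case)
qed simp

declare rec_intervals.simps [simp del]

definition disc_bids :: "auction \<Rightarrow> real \<Rightarrow> (real \<times> nat) set" where
  "disc_bids A p = {(\<alpha>, i) | \<alpha> \<beta> i. (\<alpha>, \<beta>) \<in> rec_intervals A p 0 1 \<and> i \<in> {1..n_col A}}"

definition disc_strategies :: "auction \<Rightarrow> real \<Rightarrow> strategy set" where
  "disc_strategies A p = {1..n_col A} \<rightarrow>\<^sub>E disc_bids A p"

lemma finite_rec_intervals: "finite (rec_intervals A p \<alpha> \<beta>)"
proof (induction A p \<alpha> \<beta> rule: rec_intervals.induct)
  case (1 A p \<alpha> \<beta>)
  then show ?case by (subst rec_intervals.simps) auto
qed

lemma finite_disc_strategies: "finite (disc_strategies A p)"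
proof -
  have "disc_bids A p \<subseteq> fst ` rec_intervals A p 0 1 \<times> {1..n_col A}"
    by (force simp: disc_bids_def)
  then have "finite (disc_bids A p)"
    by (rule finite_subset) (simp add: finite_rec_intervals)
  then show ?thesis
    unfolding disc_strategies_def by (intro finite_PiE) auto
qed

definition lp_feasible ::
  "mechanism \<Rightarrow> auction \<Rightarrow> (nat \<Rightarrow> real) \<Rightarrow> real \<Rightarrow> strategy pmf \<Rightarrow> (nat \<Rightarrow> real) \<Rightarrow> bool" where
  "lp_feasible mech A t p \<gamma> q \<longleftrightarrow>
     set_pmf \<gamma> \<subseteq> disc_strategies A p \<and>
     (\<forall>i\<in>{1..n_col A}. q i \<ge> 0) \<and>
     (\<forall>i\<in>{1..n_col A}.
        (\<Sum>b\<in>disc_strategies A p. pmf \<gamma> b * exp_revenue A i b) - q i \<ge> t i - p) \<and>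
     (\<Sum>i = 1..n_col A. q i) \<ge>
       (\<Sum>b\<in>disc_strategies A p. pmf \<gamma> b * (\<Sum>i = 1..n_col A. exp_payment mech A i b))"

definition lp_objective :: "mechanism \<Rightarrow> auction \<Rightarrow> real \<Rightarrow> strategy pmf \<Rightarrow> real" where
  "lp_objective mech A p \<gamma> =
     (\<Sum>b\<in>disc_strategies A p.
        pmf \<gamma> b * (\<Sum>i = 1..n_col A. exp_revenue A i b - exp_payment mech A i b))"

definition lp_opt :: "mechanism \<Rightarrow> auction \<Rightarrow> (nat \<Rightarrow> real) \<Rightarrow> real \<Rightarrow> ereal" where
  "lp_opt mech A t p =
     (SUP (\<gamma>, q) \<in> {(\<gamma>, q). lp_feasible mech A t p \<gamma> q}. ereal (lp_objective mech A p \<gamma>))"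

end

theory Submission
  imports Defs
begin

text \<open>
  Transfers can be eliminated: for distributions with \<open>E r\<^sub>i \<ge> t\<^sub>i\<close> and total welfare at least
  \<open>\<Sum> t\<^sub>i\<close>, the transfers \<open>q\<^sub>i = E r\<^sub>i - t\<^sub>i\<close> work. By convex duality it then suffices to find,
  for all weights \<open>a\<^sub>i \<ge> 1\<close>, one discretized strategy with a large value of \<open>\<Sum> a\<^sub>i r\<^sub>i - \<pi>\<^sub>i\<close>.

  If \<open>a\<^sub>i v\<^sub>i \<le> 1\<close> for all \<open>i\<close>, rounding each bid down to a left end point loses at most \<open>p\<close> per
  colluder. The left end points do not include \<open>1\<close>, but giving up a bid of \<open>1\<close> is harmless here:
  clicks won against external bids of \<open>1\<close> cost \<open>1\<close> each. Colluders with \<open>a\<^sub>i v\<^sub>i > 1\<close> would want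
  to buy such clicks. For them the hypothesis \<open>r\<^sub>i - \<pi>\<^sub>i \<ge> t\<^sub>i\<close> at a single strategy is
  used: \<open>\<Sum> a\<^sub>i r\<^sub>i - \<pi>\<^sub>i\<close> is supermodular on decreasing sequences of bids, so that raising the
  bids at least to those of this strategy yields the revenue \<open>t\<^sub>i\<close> demanded by the weights.
\<close>

section \<open>Ranking and payments\<close>

text \<open>The slack \<open>p\<close> in each revenue constraint and \<open>p * n_col A\<close> in
  the objective combine, after weighting, to an allowed loss of \<open>a i * p\<close> per colluder,
  whereas rounding costs at most \<open>p\<close>. The real obstacle is the bid 1: no left end point
  reaches it, and the clicks then lost to external bids of 1 need not have small probability.
  Pointwise maximum and minimum of strategies would mix up two orders of the colluders. A strategy
  is therefore split into an order \<open>P\<close> and a nonincreasing bid sequence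
  \<open>B\<close> indexed by position. Clicks and prices depend on position and sequence only,
  total payments do not depend on the order, and by rearrangement the order may be taken to be that
  of the weighted values. Large weights are reached from harmless ones by stretching all of them by
  one common factor at a time. This preserves the order of the weighted values, and the required and
  the achieved revenue of the group scale alike, so that only their comparison matters.\<close>

lemma nth_gt_iff_sorted_desc:
  fixes ys :: "real list"
  assumes "sorted_wrt (\<ge>) ys" "i < length ys"
  shows "x < ys ! i \<longleftrightarrow> i < length (filter (\<lambda>y. x < y) ys)"
  using assms
proof (induction ys arbitrary: i)
  case (Cons y ys)
  show ?case
  proof (cases "x < y")
    case True
    then show ?thesis using Cons by (cases i) auto
  next
    case False
    then have "filter (\<lambda>y. x < y) ys = []" using Cons.prems(1)
      by (auto simp: filter_empty_conv)
    moreover have "(y # ys) ! i \<le> y" using Cons.prems by (cases i) auto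
    ultimately show ?thesis using False by auto
  qed
qed simp

lemma set_agents: "set (agents A) = Colluder ` {1..n_col A} \<union> External ` {1..n_ext A}"
  by (auto simp: agents_def)

lemma distinct_agents: "distinct (agents A)"
  by (auto simp: agents_def distinct_map inj_on_def simp del: upt_Suc)

lemma length_agents: "length (agents A) = n_col A + n_ext A"
  by (simp add: agents_def)

lemma card_agents:
  "card {a \<in> set (agents A). Q a} =
     card {i \<in> {1..n_col A}. Q (Colluder i)} + card {j \<in> {1..n_ext A}. Q (External j)}"
proof -
  have "{a \<in> set (agents A). Q a} =
      Colluder ` {i \<in> {1..n_col A}. Q (Colluder i)} \<union> External ` {j \<in> {1..n_ext A}. Q (External j)}"
    by (auto simp: set_agents)
  then show ?thesis
    by (simp only:) (subst card_Un_disjoint, auto simp: card_image inj_on_def)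
qed

definition ext_above :: "auction \<Rightarrow> (nat \<Rightarrow> real) \<Rightarrow> real \<Rightarrow> nat" where
  "ext_above A be x = card {j \<in> {1..n_ext A}. x < be j}"

definition col_above :: "auction \<Rightarrow> strategy \<Rightarrow> real \<Rightarrow> nat" where
  "col_above A bc x = card {i \<in> {1..n_col A}. x < fst (bc i)}"

text \<open>Two colluders are compared without looking at the external profile, so
  \<open>\<lambda>_. 0\<close> is only a dummy.\<close>

definition place :: "auction \<Rightarrow> strategy \<Rightarrow> nat \<Rightarrow> nat" where
  "place A bc i =
     card {i' \<in> {1..n_col A}. ranked_above bc (\<lambda>_. 0) (Colluder i') (Colluder i)} + 1"

text \<open>Ties against external agents go to the colluder, so exactly the strictly larger external
  bids stand above. The part depending on \<open>be\<close> sees only the colluder's own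
  bid.\<close>

lemma rank_Colluder: "rank A bc be (Colluder i) = place A bc i + ext_above A be (fst (bc i))"
  by (simp add: rank_def card_agents place_def ext_above_def)

text \<open>Describing the order statistic by its superlevel sets serves both the threshold integral
  for payments and measurability.\<close>

lemma kth_bid_gt_iff:
  assumes "1 \<le> k" "k \<le> n_col A + n_ext A"
  shows "x < kth_bid A bc be k \<longleftrightarrow> k \<le> col_above A bc x + ext_above A be x"
proof -
  let ?l = "map (bid bc be) (agents A)"
  have "x < kth_bid A bc be k \<longleftrightarrow> k - 1 < length (filter (\<lambda>y. x < y) (rev (sort ?l)))"
    using assms
    by (simp add: kth_bid_def length_agents) (subst nth_gt_iff_sorted_desc, auto simp: sorted_wrt_rev length_agents)
  also have "length (filter (\<lambda>y. x < y) (rev (sort ?l))) = length (filter (\<lambda>y. x < y) ?l)"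
    by (metis mset_filter mset_rev mset_sort size_mset)
  also have "\<dots> = card {a \<in> set (agents A). x < bid bc be a}"
    by (simp add: filter_map o_def distinct_length_filter distinct_agents Int_def conj_commute)
  also have "\<dots> = col_above A bc x + ext_above A be x"
    by (simp add: card_agents col_above_def ext_above_def)
  finally show ?thesis using assms by auto
qed

lemma col_above_le: "col_above A bc x \<le> n_col A"
  and ext_above_le: "ext_above A be x \<le> n_ext A"
proof -
  have "card {i \<in> {1..n_col A}. x < fst (bc i)} \<le> card {1..n_col A}"
    by (rule card_mono) auto
  moreover have "card {j \<in> {1..n_ext A}. x < be j} \<le> card {1..n_ext A}"
    by (rule card_mono) auto
  ultimately show "col_above A bc x \<le> n_col A" "ext_above A be x \<le> n_ext A"
    by (auto simp: col_above_def ext_above_def)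
qed

lemma kth_bid_gt_iff':
  assumes "1 \<le> k" "0 \<le> x"
  shows "x < kth_bid A bc be k \<longleftrightarrow> k \<le> col_above A bc x + ext_above A be x"
proof (cases "k \<le> n_col A + n_ext A")
  case False
  then show ?thesis
    using assms col_above_le[of A bc x] ext_above_le[of A be x] by (simp add: kth_bid_def)
qed (use assms in \<open>simp add: kth_bid_gt_iff\<close>)

lemma ext_above_antimono: "x \<le> y \<Longrightarrow> ext_above A be y \<le> ext_above A be x"
  unfolding ext_above_def by (rule card_mono) auto

lemma has_integral_threshold:
  fixes c :: real
  assumes "0 \<le> c" "c \<le> 1"
  shows "((\<lambda>x. if x < c then 1 else 0) has_integral c) {0..1::real}"
proof -
  have "((\<lambda>x. 1::real) has_integral c) {0..c}"
    using has_integral_const_real[of "1::real" 0 c] assms by simp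
  then have "((\<lambda>x. if x \<in> {0..c} then 1 else (0::real)) has_integral c) {0..1}"
    by (subst has_integral_restrict) (use assms in auto)
  then show ?thesis
    by (rule has_integral_spike[where S = "{c}", rotated 2]) (use assms in auto)
qed

locale ad_setting =
  fixes A :: auction and mech :: mechanism
  assumes ad: "ad_auction A"
begin

abbreviation "cols \<equiv> {1..n_col A}"

lemma ctr_nonneg: "1 \<le> k \<Longrightarrow> 0 \<le> ctr A k"
  and ctr_le_1: "1 \<le> k \<Longrightarrow> ctr A k \<le> 1"
  using ad by (cases "k \<le> n_slots A"; auto simp: ad_auction_def)+

lemma ctr_zero: "n_slots A < k \<Longrightarrow> ctr A k = 0"
  using ad by (auto simp: ad_auction_def)

lemma ctr_antimono:
  assumes "1 \<le> k" "k \<le> l"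
  shows "ctr A l \<le> ctr A k"
  using assms(2)
proof (induction l rule: dec_induct)
  case (step l)
  have "ctr A (Suc l) \<le> ctr A l"
  proof (cases "Suc l \<le> n_slots A")
    case True
    then show ?thesis using ad assms step by (auto simp: ad_auction_def)
  next
    case False
    then show ?thesis using ctr_zero[of "Suc l"] ctr_nonneg[of l] assms step by auto
  qed
  then show ?case using step by simp
qed simp

text \<open>A price is the integral over thresholds of an indicator, so the payment of the agent of
  rank \<open>k\<close> is the integral of \<open>ctr A k - share k n\<close>, where \<open>n\<close> is the number of bids above the
  threshold.\<close>

definition share :: "nat \<Rightarrow> nat \<Rightarrow> real" where
  "share k n = (case mech of GSP \<Rightarrow> if n \<le> k then ctr A k else 0 | VCG \<Rightarrow> ctr A (max k n))"

lemma share_bounds: "1 \<le> k \<Longrightarrow> 0 \<le> share k n \<and> share k n \<le> ctr A k"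
  by (auto simp: share_def ctr_nonneg intro: ctr_antimono split: mechanism.split)

lemma share_antimono: "1 \<le> k \<Longrightarrow> n \<le> n' \<Longrightarrow> share k n' \<le> share k n"
  by (auto simp: share_def ctr_nonneg intro: ctr_antimono split: mechanism.split)

lemma share_GSP: "mech = GSP \<Longrightarrow> share k n = (if n \<le> k then ctr A k else 0)"
  and share_VCG: "mech = VCG \<Longrightarrow> share k n = ctr A (max k n)"
  unfolding share_def by simp_all

lemma payment_has_integral:
  assumes "1 \<le> k" "k = rank A bc be (Colluder i)"
    and kb: "\<And>j. 0 \<le> kth_bid A bc be j \<and> kth_bid A bc be j \<le> 1"
  shows "((\<lambda>x. ctr A k - share k (col_above A bc x + ext_above A be x))
           has_integral payment mech A bc be i) {0..1}"
proof (cases mech)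
  case GSP
  have "((\<lambda>x. ctr A k * (if x < kth_bid A bc be (k + 1) then 1 else 0))
          has_integral ctr A k * kth_bid A bc be (k + 1)) {0..1}"
    by (intro has_integral_mult_right has_integral_threshold) (use kb in auto)
  moreover have "payment mech A bc be i = ctr A k * kth_bid A bc be (k + 1)"
    by (simp add: GSP assms(2)[symmetric] Let_def)
  moreover have "ctr A k * (if x < kth_bid A bc be (k + 1) then 1 else 0)
      = ctr A k - share k (col_above A bc x + ext_above A be x)" if "x \<in> {0..1}" for x
    using that by (simp add: kth_bid_gt_iff' share_GSP[OF GSP])
  ultimately show ?thesis
    by (simp only:, elim has_integral_eq[rotated]) auto
next
  case VCG
  show ?thesis
  proof (cases "k \<le> n_slots A")
    case True
    let ?n = "\<lambda>x. col_above A bc x + ext_above A be x"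
    have tele: "(\<Sum>j = k + 1..n_slots A + 1. (if j \<le> c then 1 else 0) * (ctr A (j - 1) - ctr A j))
        = ctr A k - ctr A (max k c)" for c
    proof -
      \<comment> \<open>The upper limit is generalised to \<open>N\<close> for the induction. The
        cut-off \<open>min c (N + 1)\<close> disappears at \<open>N = n_slots A\<close> because
        \<open>ctr A\<close> vanishes beyond the slots.\<close>
      have "(\<Sum>j = k + 1..N + 1. (if j \<le> c then 1 else 0) * (ctr A (j - 1) - ctr A j))
        = ctr A k - ctr A (max k (min c (N + 1)))" if "k \<le> N" for N
        using that
      proof (induction N rule: dec_induct)
        case base
        then show ?case by (cases "c = k") (auto simp: max_def min_def)
      next
        case (step N)
        then show ?case by (cases "c \<le> N + 1"; cases "c = N + 2") (auto simp: max_def min_def)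
      qed
      from this[OF True] show ?thesis
        using ctr_zero[of c] ctr_zero[of "n_slots A + 1"] True by (auto simp: max_def min_def)
    qed
    have "((\<lambda>x. \<Sum>j = k + 1..n_slots A + 1.
             (if x < kth_bid A bc be j then 1 else 0) * (ctr A (j - 1) - ctr A j))
          has_integral (\<Sum>j = k + 1..n_slots A + 1. kth_bid A bc be j * (ctr A (j - 1) - ctr A j))) {0..1}"
      by (intro has_integral_sum has_integral_mult_left has_integral_threshold) (use kb in auto)
    moreover have "(\<Sum>j = k + 1..n_slots A + 1.
             (if x < kth_bid A bc be j then 1 else 0) * (ctr A (j - 1) - ctr A j))
         = ctr A k - share k (?n x)" if "x \<in> {0..1}" for x
    proof -
      have "(\<Sum>j = k + 1..n_slots A + 1.
             (if x < kth_bid A bc be j then 1 else 0) * (ctr A (j - 1) - ctr A j))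
        = (\<Sum>j = k + 1..n_slots A + 1. (if j \<le> ?n x then 1 else 0) * (ctr A (j - 1) - ctr A j))"
        by (intro sum.cong refl) (use that in \<open>simp add: kth_bid_gt_iff'\<close>)
      also have "\<dots> = ctr A k - share k (?n x)"
        by (simp only: tele share_VCG[OF VCG])
      finally show ?thesis .
    qed
    moreover have "payment mech A bc be i =
        (\<Sum>j = k + 1..n_slots A + 1. kth_bid A bc be j * (ctr A (j - 1) - ctr A j))"
      using True by (simp add: VCG assms(2)[symmetric] Let_def)
    ultimately show ?thesis
      by (simp only:, elim has_integral_eq[rotated]) auto
  next
    case False
    then have "payment mech A bc be i = 0"
      by (simp add: VCG assms(2)[symmetric] Let_def)
    moreover have "ctr A k - share k n = 0" for n
      using False by (simp add: share_VCG[OF VCG] ctr_zero)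
    ultimately show ?thesis by simp
  qed
qed

end

section \<open>Bid sequences\<close>

lemma (in ad_setting) finite_ext_profiles: "finite (ext_profiles A)"
proof -
  have "{x. 0 \<le> x \<and> x \<le> 1 \<and> (\<exists>k::nat. x = real k / 2 ^ bits A)}
      \<subseteq> (\<lambda>k. real k / 2 ^ bits A) ` {..2 ^ bits A}"
  proof clarify
    fix k :: nat assume "real k / 2 ^ bits A \<le> 1"
    then have "real k \<le> real (2 ^ bits A)" by simp
    then show "real k / 2 ^ bits A \<in> (\<lambda>k. real k / 2 ^ bits A) ` {..2 ^ bits A}"
      unfolding of_nat_le_iff by blast
  qed
  then have "finite {x. 0 \<le> x \<and> x \<le> 1 \<and> (\<exists>k::nat. x = real k / 2 ^ bits A)}"
    by (rule finite_subset) simp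
  then show ?thesis
    unfolding ext_profiles_def by (intro finite_PiE) auto
qed

lemma (in ad_setting) ext_dist_profiles: "set_pmf (ext_dist A) \<subseteq> ext_profiles A"
  using ad unfolding ad_auction_def by blast

lemma (in ad_setting) integrable_ext_dist: "integrable (measure_pmf (ext_dist A)) (f :: _ \<Rightarrow> real)"
  using finite_subset[OF ext_dist_profiles finite_ext_profiles]
  by (rule integrable_measure_pmf_finite)

lemma ext_bid_bounds:
  assumes "be \<in> ext_profiles A" "j \<in> {1..n_ext A}"
  shows "0 \<le> be j \<and> be j \<le> 1"
  using PiE_mem[OF assms(1)[unfolded ext_profiles_def] assms(2)] by simp

lemma kth_bid_bounds:
  assumes "be \<in> ext_profiles A" "\<And>i. i \<in> {1..n_col A} \<Longrightarrow> 0 \<le> fst (bc i) \<and> fst (bc i) \<le> 1"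
  shows "0 \<le> kth_bid A bc be k \<and> kth_bid A bc be k \<le> 1"
proof (cases "1 \<le> k \<and> k \<le> n_col A + n_ext A")
  case False
  show ?thesis unfolding kth_bid_def if_not_P[OF False] by simp
next
  case True
  then have "rev (sort (map (bid bc be) (agents A))) ! (k - 1)
      \<in> set (rev (sort (map (bid bc be) (agents A))))"
    by (intro nth_mem) (auto simp: length_agents)
  then have "kth_bid A bc be k \<in> bid bc be ` set (agents A)"
    using True by (simp add: kth_bid_def)
  then obtain a where "a \<in> set (agents A)" "kth_bid A bc be k = bid bc be a"
    by blast
  then consider i where "i \<in> {1..n_col A}" "kth_bid A bc be k = fst (bc i)"
    | j where "j \<in> {1..n_ext A}" "kth_bid A bc be k = be j"
    by (auto simp: set_agents)
  then show ?thesis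
    by cases (use assms(2) ext_bid_bounds[OF assms(1)] in simp_all)
qed

section \<open>The order among the colluders and bids listed by position\<close>

lemma ranked_above_trans:
  "\<lbrakk>ranked_above bc be (Colluder i) (Colluder i'); ranked_above bc be (Colluder i') (Colluder i'')\<rbrakk>
   \<Longrightarrow> ranked_above bc be (Colluder i) (Colluder i'')"
  unfolding ranked_above.simps by linarith

lemma place_less:
  assumes "i' \<in> {1..n_col A}" "ranked_above bc (\<lambda>_. 0) (Colluder i') (Colluder i)"
  shows "place A bc i' < place A bc i"
proof -
  have "\<not> ranked_above bc (\<lambda>_. 0) (Colluder i') (Colluder i')"
    by simp
  then have "{i'' \<in> {1..n_col A}. ranked_above bc (\<lambda>_. 0) (Colluder i'') (Colluder i')}
      \<subset> {i'' \<in> {1..n_col A}. ranked_above bc (\<lambda>_. 0) (Colluder i'') (Colluder i)}"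
    using assms(1) ranked_above_trans[OF _ assms(2)] assms(2) by blast
  then show ?thesis
    by (simp add: place_def psubset_card_mono)
qed

lemma ranked_above_total:
  "i \<noteq> i' \<Longrightarrow> ranked_above bc be (Colluder i) (Colluder i') \<or>
    ranked_above bc be (Colluder i') (Colluder i)"
  unfolding ranked_above.simps by linarith

lemma place_less_iff:
  assumes "i \<in> {1..n_col A}" "i' \<in> {1..n_col A}"
  shows "place A bc i' < place A bc i \<longleftrightarrow> ranked_above bc (\<lambda>_. 0) (Colluder i') (Colluder i)"
proof
  assume less: "place A bc i' < place A bc i"
  then have "\<not> ranked_above bc (\<lambda>_. 0) (Colluder i) (Colluder i')"
    using place_less[OF assms(1), of bc i'] by linarith
  then show "ranked_above bc (\<lambda>_. 0) (Colluder i') (Colluder i)"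
    using ranked_above_total[of i i'] less by blast
qed (rule place_less[OF assms(2)])

lemma place_bij: "bij_betw (place A bc) {1..n_col A} {1..n_col A}"
proof -
  have inj: "inj_on (place A bc) {1..n_col A}"
    using place_less_iff[of _ A _ bc] ranked_above_total[of _ _ bc "\<lambda>_. 0"]
    by (intro inj_onI) (metis less_irrefl)
  have "place A bc i \<in> {1..n_col A}" if "i \<in> {1..n_col A}" for i
  proof -
    have "card {i' \<in> {1..n_col A}. ranked_above bc (\<lambda>_. 0) (Colluder i') (Colluder i)}
        \<le> card ({1..n_col A} - {i})"
      by (rule card_mono) auto
    then show ?thesis using that by (auto simp: place_def)
  qed
  then have "place A bc ` {1..n_col A} = {1..n_col A}"
    using inj by (intro endo_inj_surj) auto
  then show ?thesis using inj by (simp add: bij_betw_def)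
qed

text \<open>Bids are indexed by position, not by colluder: such sequences form a lattice under
  pointwise maximum and minimum.\<close>

definition ladder :: "auction \<Rightarrow> (nat \<Rightarrow> real) \<Rightarrow> bool" where
  "ladder A B \<longleftrightarrow> (\<forall>k\<in>{1..n_col A}. 0 \<le> B k \<and> B k \<le> 1) \<and>
     (\<forall>k\<in>{1..n_col A}. \<forall>l\<in>{1..n_col A}. k \<le> l \<longrightarrow> B l \<le> B k)"

definition level_count :: "auction \<Rightarrow> (nat \<Rightarrow> real) \<Rightarrow> real \<Rightarrow> nat" where
  "level_count A B x = card {k \<in> {1..n_col A}. x < B k}"

definition placed :: "auction \<Rightarrow> strategy \<Rightarrow> (nat \<Rightarrow> nat) \<Rightarrow> (nat \<Rightarrow> real) \<Rightarrow> bool" where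
  "placed A bc P B \<longleftrightarrow> bij_betw P {1..n_col A} {1..n_col A} \<and> ladder A B \<and>
     (\<forall>i\<in>{1..n_col A}. place A bc i = P i \<and> fst (bc i) = B (P i))"

text \<open>The tie-breaker lies in \<open>{1..n_col A}\<close>, as \<open>disc_bids\<close>
  demands, and decreases with the position, so tied colluders rank by \<open>P\<close>. Bid values
  alone could not realise an arbitrary order of tied colluders.\<close>

definition seq_strategy :: "auction \<Rightarrow> (nat \<Rightarrow> nat) \<Rightarrow> (nat \<Rightarrow> real) \<Rightarrow> strategy" where
  "seq_strategy A P B = (\<lambda>i\<in>{1..n_col A}. (B (P i), n_col A + 1 - P i))"

lemma ladder_le: "\<lbrakk>ladder A B; k \<in> {1..n_col A}; l \<in> {1..n_col A}; k \<le> l\<rbrakk> \<Longrightarrow> B l \<le> B k"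
  unfolding ladder_def by blast

lemma ladder_bounds: "\<lbrakk>ladder A B; k \<in> {1..n_col A}\<rbrakk> \<Longrightarrow> 0 \<le> B k \<and> B k \<le> 1"
  unfolding ladder_def by blast

lemma level_count_antimono: "x \<le> y \<Longrightarrow> level_count A B y \<le> level_count A B x"
  unfolding level_count_def by (rule card_mono) auto

lemma level_count_le: "level_count A B x \<le> n_col A"
proof -
  have "card {k \<in> {1..n_col A}. x < B k} \<le> card {1..n_col A}"
    by (rule card_mono) auto
  then show ?thesis by (simp add: level_count_def)
qed

text \<open>By monotonicity the positions with a bid above \<open>x\<close> form an initial segment,
  and the count is its length.\<close>

lemma le_level_count_iff:
  assumes "ladder A B" "k \<in> {1..n_col A}"
  shows "k \<le> level_count A B x \<longleftrightarrow> x < B k"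
proof
  assume "x < B k"
  have "x < B l" if "l \<in> {1..k}" for l
    using ladder_le[OF assms(1), of l k] assms(2) that \<open>x < B k\<close> by auto
  then have "{1..k} \<subseteq> {k \<in> {1..n_col A}. x < B k}"
    using assms(2) by auto
  then have "card {1..k} \<le> level_count A B x"
    unfolding level_count_def by (rule card_mono[rotated]) simp
  then show "k \<le> level_count A B x" by simp
next
  assume k: "k \<le> level_count A B x"
  show "x < B k"
  proof (rule ccontr)
    assume "\<not> x < B k"
    then have "l < k" if "l \<in> {1..n_col A}" "x < B l" for l
      using ladder_le[OF assms(1) assms(2), of l] that by (cases "l < k") auto
    then have "{k \<in> {1..n_col A}. x < B k} \<subseteq> {1..<k}" by auto
    then have "level_count A B x \<le> card {1..<k}"
      unfolding level_count_def by (rule card_mono[rotated]) simp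
    then show False using k assms(2) by auto
  qed
qed

lemma placed_exists:
  assumes "\<And>i. i \<in> {1..n_col A} \<Longrightarrow> 0 \<le> fst (bc i) \<and> fst (bc i) \<le> 1"
  shows "placed A bc (place A bc) (\<lambda>k. fst (bc (inv_into {1..n_col A} (place A bc) k)))"
proof -
  let ?C = "{1..n_col A}" let ?P = "place A bc" let ?Q = "inv_into ?C ?P"
  have Q: "?Q k \<in> ?C" "?P (?Q k) = k" if "k \<in> ?C" for k
  proof -
    have "k \<in> ?P ` ?C"
      using that place_bij[of A bc] unfolding bij_betw_def by blast
    then show "?Q k \<in> ?C" "?P (?Q k) = k"
      by (rule inv_into_into, rule f_inv_into_f)
  qed
  have "fst (bc (?Q l)) \<le> fst (bc (?Q k))" if "k \<in> ?C" "l \<in> ?C" "k \<le> l" for k l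
  proof (rule ccontr)
    assume "\<not> ?thesis"
    then have "?P (?Q l) < ?P (?Q k)"
      using Q that by (intro place_less) auto
    then show False using Q that by simp
  qed
  moreover have "0 \<le> fst (bc (?Q k)) \<and> fst (bc (?Q k)) \<le> 1" if "k \<in> ?C" for k
    using assms Q that by blast
  ultimately have "ladder A (\<lambda>k. fst (bc (?Q k)))"
    unfolding ladder_def by blast
  moreover have "?Q (?P i) = i" if "i \<in> ?C" for i
    using that place_bij[of A bc] by (simp add: bij_betw_def)
  ultimately show ?thesis
    using place_bij[of A bc] by (simp add: placed_def)
qed

lemma placed_seq_strategy:
  assumes P: "bij_betw P {1..n_col A} {1..n_col A}" and B: "ladder A B"
  shows "placed A (seq_strategy A P B) P B"
proof -
  let ?C = "{1..n_col A}" let ?bc = "seq_strategy A P B"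
  have PC: "P i \<in> ?C" if "i \<in> ?C" for i
    using bij_betw_apply[OF P that] .
  have inj: "P i = P j \<longleftrightarrow> i = j" if "i \<in> ?C" "j \<in> ?C" for i j
    using inj_on_eq_iff[OF bij_betw_imp_inj_on[OF P] that] .
  have less: "ranked_above ?bc (\<lambda>_. 0) (Colluder j) (Colluder i)" if "i \<in> ?C" "j \<in> ?C" "P j < P i" for i j
  proof -
    have "B (P i) \<le> B (P j)"
      using PC that by (intro ladder_le[OF B]) auto
    moreover have "n_col A + 1 - P i < n_col A + 1 - P j"
      using that PC[OF that(1)] by auto
    ultimately show ?thesis
      using that(1,2) by (simp add: seq_strategy_def less_le)
  qed
  have iff: "ranked_above ?bc (\<lambda>_. 0) (Colluder j) (Colluder i) \<longleftrightarrow> P j < P i" if "i \<in> ?C" "j \<in> ?C" for i j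
  proof
    assume above: "ranked_above ?bc (\<lambda>_. 0) (Colluder j) (Colluder i)"
    then have "j \<noteq> i" "\<not> ranked_above ?bc (\<lambda>_. 0) (Colluder i) (Colluder j)"
      by auto
    then show "P j < P i"
      using less[OF that(2,1)] inj[OF that] by (metis linorder_neqE_nat)
  qed (rule less[OF that])
  have "place A ?bc i = P i" if i: "i \<in> ?C" for i
  proof -
    have "{j \<in> ?C. ranked_above ?bc (\<lambda>_. 0) (Colluder j) (Colluder i)} = {j \<in> ?C. P j < P i}"
      using iff[OF i] by blast
    moreover have "bij_betw P {j \<in> ?C. P j < P i} {k \<in> ?C. k < P i}"
    proof (rule bij_betw_imageI)
      show "inj_on P {j \<in> ?C. P j < P i}"
        using inj by (intro inj_onI) blast
      have "P ` {j \<in> ?C. P j < P i} = {k \<in> P ` ?C. k < P i}"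
        by auto
      then show "P ` {j \<in> ?C. P j < P i} = {k \<in> ?C. k < P i}"
        unfolding bij_betw_imp_surj_on[OF P] .
    qed
    moreover have "{k \<in> ?C. k < P i} = {1..<P i}"
      using PC[OF i] by auto
    ultimately show ?thesis
      using PC[OF i] by (simp add: place_def bij_betw_same_card)
  qed
  then show ?thesis
    using P B by (simp add: placed_def seq_strategy_def)
qed

lemma placed_col_above:
  assumes "placed A bc P B"
  shows "col_above A bc x = level_count A B x"
proof -
  have P: "bij_betw P {1..n_col A} {1..n_col A}"
    and PB: "\<And>i. i \<in> {1..n_col A} \<Longrightarrow> fst (bc i) = B (P i)"
    using assms by (simp_all add: placed_def)
  have "bij_betw P {i \<in> {1..n_col A}. x < fst (bc i)} {k \<in> {1..n_col A}. x < B k}"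
  proof (rule bij_betw_imageI)
    show "inj_on P {i \<in> {1..n_col A}. x < fst (bc i)}"
      by (rule inj_on_subset[OF bij_betw_imp_inj_on[OF P]]) blast
    have "P ` {i \<in> {1..n_col A}. x < fst (bc i)} = {k \<in> P ` {1..n_col A}. x < B k}"
      using PB by auto
    then show "P ` {i \<in> {1..n_col A}. x < fst (bc i)} = {k \<in> {1..n_col A}. x < B k}"
      unfolding bij_betw_imp_surj_on[OF P] .
  qed
  then show ?thesis
    by (simp add: col_above_def level_count_def bij_betw_same_card)
qed

section \<open>Clicks and prices by position\<close>

context ad_setting
begin

text \<open>Only the own entry \<open>B k\<close> matters here, which makes clicks modular under
  maximum and minimum; payments see the whole ladder through \<open>level_count\<close>.\<close>

definition seq_rank :: "(nat \<Rightarrow> real) \<Rightarrow> (nat \<Rightarrow> real) \<Rightarrow> nat \<Rightarrow> nat" where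
  "seq_rank be B k = k + ext_above A be (B k)"

definition seq_share :: "(nat \<Rightarrow> real) \<Rightarrow> (nat \<Rightarrow> real) \<Rightarrow> nat \<Rightarrow> real \<Rightarrow> real" where
  "seq_share be B k x = share (seq_rank be B k) (level_count A B x + ext_above A be x)"

definition seq_pay :: "(nat \<Rightarrow> real) \<Rightarrow> (nat \<Rightarrow> real) \<Rightarrow> nat \<Rightarrow> real" where
  "seq_pay be B k = ctr A (seq_rank be B k) - integral {0..1} (seq_share be B k)"

definition clicks :: "(nat \<Rightarrow> real) \<Rightarrow> nat \<Rightarrow> real" where
  "clicks B k = measure_pmf.expectation (ext_dist A) (\<lambda>be. ctr A (seq_rank be B k))"

definition price :: "(nat \<Rightarrow> real) \<Rightarrow> nat \<Rightarrow> real" where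
  "price B k = measure_pmf.expectation (ext_dist A) (\<lambda>be. seq_pay be B k)"

lemma seq_share_integrable:
  assumes "1 \<le> k"
  shows "seq_share be B k integrable_on {0..1}"
proof (intro integrable_on_mono_on mono_onI)
  fix x y :: real assume "x \<le> y"
  then have "level_count A B y + ext_above A be y \<le> level_count A B x + ext_above A be x"
    by (intro add_mono level_count_antimono ext_above_antimono)
  then show "seq_share be B k x \<le> seq_share be B k y"
    unfolding seq_share_def using assms by (intro share_antimono) (auto simp: seq_rank_def)
qed

lemma placed_outcome:
  assumes "be \<in> ext_profiles A" "placed A bc P B" "i \<in> cols"
  shows "payment mech A bc be i = seq_pay be B (P i)"
    and "revenue A bc be i = ctr A (seq_rank be B (P i)) * val A i"
proof -
  have P: "bij_betw P cols cols" and B: "ladder A B"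
    and PB: "\<And>i. i \<in> cols \<Longrightarrow> place A bc i = P i \<and> fst (bc i) = B (P i)"
    using assms(2) by (auto simp: placed_def)
  have PC: "P i \<in> cols" if "i \<in> cols" for i
    using P that by (auto simp: bij_betw_def)
  have rank: "rank A bc be (Colluder i) = seq_rank be B (P i)"
    using PB[OF assms(3)] by (simp add: rank_Colluder seq_rank_def)
  then show "revenue A bc be i = ctr A (seq_rank be B (P i)) * val A i"
    by (simp add: revenue_def)
  note placed_col_above[OF assms(2)]
  moreover have "1 \<le> seq_rank be B (P i)"
    using PC[OF assms(3)] by (simp add: seq_rank_def)
  moreover have "0 \<le> kth_bid A bc be j \<and> kth_bid A bc be j \<le> 1" for j
    using PB PC ladder_bounds[OF B] by (intro kth_bid_bounds assms(1)) simp
  ultimately have "((\<lambda>x. ctr A (seq_rank be B (P i)) - seq_share be B (P i) x)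
      has_integral payment mech A bc be i) {0..1}"
    using payment_has_integral[OF _ rank[symmetric]] by (simp add: seq_share_def)
  moreover have "((\<lambda>x. ctr A (seq_rank be B (P i)) - seq_share be B (P i) x)
      has_integral seq_pay be B (P i)) {0..1}"
    unfolding seq_pay_def using PC[OF assms(3)]
    by (intro has_integral_diff integrable_integral seq_share_integrable)
       (use has_integral_const_real[of "ctr A (seq_rank be B (P i))" 0 1] in auto)
  ultimately show "payment mech A bc be i = seq_pay be B (P i)"
    by (rule has_integral_unique)
qed

lemma placed_expected:
  assumes "placed A bc P B" "i \<in> cols"
  shows "exp_payment mech A i bc = price B (P i)"
    and "exp_revenue A i bc = clicks B (P i) * val A i"
proof -
  have *: "measure_pmf.expectation (ext_dist A) f = measure_pmf.expectation (ext_dist A) g"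
    if "\<And>be. be \<in> ext_profiles A \<Longrightarrow> f be = g be" for f g :: "_ \<Rightarrow> real"
  proof (rule integral_cong_AE)
    show "AE be in measure_pmf (ext_dist A). f be = g be"
      unfolding AE_measure_pmf_iff using that ext_dist_profiles by blast
  qed simp_all
  show "exp_payment mech A i bc = price B (P i)"
    unfolding exp_payment_def price_def
    by (intro * placed_outcome[OF _ assms])
  have "exp_revenue A i bc
      = measure_pmf.expectation (ext_dist A) (\<lambda>be. ctr A (seq_rank be B (P i)) * val A i)"
    unfolding exp_revenue_def by (intro * placed_outcome[OF _ assms])
  then show "exp_revenue A i bc = clicks B (P i) * val A i"
    by (simp add: clicks_def)
qed

lemma expectation_mono:
  fixes f g :: "(nat \<Rightarrow> real) \<Rightarrow> real"
  assumes "\<And>be. be \<in> ext_profiles A \<Longrightarrow> f be \<le> g be"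
  shows "measure_pmf.expectation (ext_dist A) f \<le> measure_pmf.expectation (ext_dist A) g"
proof (rule integral_mono_AE)
  show "AE be in measure_pmf (ext_dist A). f be \<le> g be"
    unfolding AE_measure_pmf_iff using assms ext_dist_profiles by blast
qed (rule integrable_ext_dist)+

text \<open>At most \<open>r\<close> bids exceed the threshold, so none ranked below
  \<open>r\<close> needs to be counted and nothing is charged there.\<close>

lemma share_below: "n \<le> r \<Longrightarrow> share r n = ctr A r"
  by (auto simp: share_def max_def split: mechanism.split)

lemma share_cases:
  "(\<forall>k n. share k n = (if n \<le> k then ctr A k else 0)) \<or> (\<forall>k n. share k n = ctr A (max k n))"
  using share_GSP share_VCG by (cases mech) blast+

text \<open>If \<open>n' \<le> r'\<close>, the left rate is 0. Otherwise
  \<open>n \<ge> n' > r' \<ge> r\<close>, so both rates are in force: \<open>ctr\<close> of the own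
  rank, reduced under VCG by \<open>ctr\<close> of the count.\<close>

lemma pay_rate_mono:
  assumes "1 \<le> r" "r \<le> r'" "n' \<le> n"
  shows "ctr A r' - share r' n' \<le> ctr A r - share r n"
proof (cases "n' \<le> r'")
  case True
  then show ?thesis using share_below share_bounds assms by simp
next
  case False
  then have "ctr A r' \<le> ctr A r" "ctr A n \<le> ctr A n'"
    using assms by (auto intro: ctr_antimono)
  then show ?thesis
    using share_cases False assms by (elim disjE) (auto simp: max_def)
qed

lemma ctr_seq_rank_bounds: "1 \<le> k \<Longrightarrow> 0 \<le> ctr A (seq_rank be B k) \<and> ctr A (seq_rank be B k) \<le> 1"
  by (simp add: seq_rank_def ctr_nonneg ctr_le_1)

lemma seq_pay_has_integral:
  assumes "1 \<le> k"
  shows "((\<lambda>x. ctr A (seq_rank be B k) - seq_share be B k x) has_integral seq_pay be B k) {0..1}"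
  unfolding seq_pay_def using assms
  by (intro has_integral_diff integrable_integral seq_share_integrable)
     (use has_integral_const_real[of "ctr A (seq_rank be B k)" 0 1] in auto)

lemma seq_pay_bounds:
  assumes "1 \<le> k"
  shows "0 \<le> seq_pay be B k" "seq_pay be B k \<le> ctr A (seq_rank be B k)"
proof -
  have sh: "0 \<le> seq_share be B k x \<and> seq_share be B k x \<le> ctr A (seq_rank be B k)" for x
    unfolding seq_share_def using assms by (intro share_bounds) (simp add: seq_rank_def)
  show "0 \<le> seq_pay be B k"
    by (rule has_integral_nonneg[OF seq_pay_has_integral[OF assms]]) (use sh in simp)
  have "((\<lambda>x. ctr A (seq_rank be B k)) has_integral ctr A (seq_rank be B k)) {0..1::real}"
    using has_integral_const_real[of "ctr A (seq_rank be B k)" 0 1] by simp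
  then show "seq_pay be B k \<le> ctr A (seq_rank be B k)"
    by (rule has_integral_le[OF seq_pay_has_integral[OF assms]]) (use sh in simp)
qed

lemma price_nonneg: "1 \<le> k \<Longrightarrow> 0 \<le> price B k"
  unfolding price_def by (intro Bochner_Integration.integral_nonneg seq_pay_bounds)

lemma clicks_bounds:
  assumes "1 \<le> k"
  shows "0 \<le> clicks B k" "clicks B k \<le> 1"
proof -
  show "0 \<le> clicks B k"
    unfolding clicks_def using ctr_seq_rank_bounds[OF assms]
    by (intro Bochner_Integration.integral_nonneg) auto
  have "clicks B k \<le> measure_pmf.expectation (ext_dist A) (\<lambda>_. 1)"
    unfolding clicks_def using ctr_seq_rank_bounds[OF assms] by (intro expectation_mono) auto
  then show "clicks B k \<le> 1" by simp
qed

lemma clicks_mono: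
  assumes "1 \<le> k" "k \<le> l" "C l \<le> B k"
  shows "clicks C l \<le> clicks B k"
  unfolding clicks_def using assms
  by (intro expectation_mono ctr_antimono) (auto simp: seq_rank_def intro: add_mono ext_above_antimono)

section \<open>The lattice of ladders and submodularity of prices\<close>

lemma level_count_max:
  assumes "ladder A B" "ladder A C"
  shows "level_count A (\<lambda>k. max (B k) (C k)) x = max (level_count A B x) (level_count A C x)"
    and "level_count A (\<lambda>k. min (B k) (C k)) x = min (level_count A B x) (level_count A C x)"
proof -
  \<comment> \<open>Level sets are initial segments of positions, so union and intersection have the
    larger and the smaller length.\<close>
  have eq: "{k \<in> cols. x < D k} = {1..level_count A D x}" if "ladder A D" for D
  proof (intro equalityI subsetI)
    fix k assume "k \<in> {k \<in> cols. x < D k}"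
    then show "k \<in> {1..level_count A D x}"
      using le_level_count_iff[OF that, of k x] by auto
  next
    fix k assume k: "k \<in> {1..level_count A D x}"
    then have "k \<in> cols" using level_count_le[of A D x] by auto
    then show "k \<in> {k \<in> cols. x < D k}"
      using le_level_count_iff[OF that, of k x] k by auto
  qed
  have "{k \<in> cols. x < max (B k) (C k)} = {1..level_count A B x} \<union> {1..level_count A C x}"
    unfolding eq[OF assms(1), symmetric] eq[OF assms(2), symmetric] by auto
  also have "\<dots> = {1..max (level_count A B x) (level_count A C x)}" by auto
  finally show "level_count A (\<lambda>k. max (B k) (C k)) x = max (level_count A B x) (level_count A C x)"
    by (simp add: level_count_def[of A "\<lambda>k. max (B k) (C k)"])
  have "{k \<in> cols. x < min (B k) (C k)} = {1..level_count A B x} \<inter> {1..level_count A C x}"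
    unfolding eq[OF assms(1), symmetric] eq[OF assms(2), symmetric] by auto
  also have "\<dots> = {1..min (level_count A B x) (level_count A C x)}" by auto
  finally show "level_count A (\<lambda>k. min (B k) (C k)) x = min (level_count A B x) (level_count A C x)"
    by (simp add: level_count_def[of A "\<lambda>k. min (B k) (C k)"])
qed

lemma ladder_max:
  assumes "ladder A B" "ladder A C"
  shows "ladder A (\<lambda>k. max (B k) (C k))" and "ladder A (\<lambda>k. min (B k) (C k))"
proof -
  have le: "B l \<le> B k" "C l \<le> C k" if "k \<in> cols" "l \<in> cols" "k \<le> l" for k l
    using ladder_le[OF assms(1) that] ladder_le[OF assms(2) that] by auto
  have bd: "0 \<le> B k \<and> B k \<le> 1" "0 \<le> C k \<and> C k \<le> 1" if "k \<in> cols" for k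
    using ladder_bounds[OF assms(1) that] ladder_bounds[OF assms(2) that] by auto
  show "ladder A (\<lambda>k. max (B k) (C k))"
    unfolding ladder_def by (intro conjI ballI impI max.mono le) (use bd in \<open>auto simp: le_max_iff_disj\<close>)
  show "ladder A (\<lambda>k. min (B k) (C k))"
    unfolding ladder_def by (intro conjI ballI impI min.mono le) (use bd in \<open>auto simp: min_le_iff_disj\<close>)
qed

text \<open>If \<open>C k \<le> B k\<close>, maximum and minimum reproduce the two ladders at
  \<open>k\<close> and equality holds. In the crossing case, the delicate thresholds
  \<open>B k \<le> x < C k\<close> contradict \<open>le\<close>. Thresholds
  \<open>x \<ge> C k\<close> leave every share full, and for \<open>x < B k\<close> all counts reach
  at least the ranks.\<close>

lemma seq_share_exchange_aux:
  assumes B: "ladder A B" and C: "ladder A C" and k: "k \<in> cols"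
    and le: "level_count A C x \<le> level_count A B x"
  shows "seq_share be B k x + seq_share be C k x
    \<le> seq_share be (\<lambda>k. max (B k) (C k)) k x + seq_share be (\<lambda>k. min (B k) (C k)) k x"
proof (cases "C k \<le> B k")
  case True
  then have "max (B k) (C k) = B k" "min (B k) (C k) = C k" by auto
  then show ?thesis
    using le by (simp add: seq_share_def seq_rank_def level_count_max[OF B C] max_absorb1 min_absorb2)
next
  case False
  define N c d r s where "N = ext_above A be x" and "c = level_count A B x"
    and "d = level_count A C x" and "r = k + ext_above A be (C k)" and "s = k + ext_above A be (B k)"
  have dc: "d \<le> c" using le by (simp add: c_def d_def)
  have rs: "r \<le> s" using False by (simp add: r_def s_def ext_above_antimono)
  have goal: "share s (c + N) + share r (d + N) \<le> share r (c + N) + share s (d + N)"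
  proof (cases "x < B k")
    case True
    then have "k \<le> d" "r \<le> d + N" "s \<le> d + N"
      using le_level_count_iff[OF C k, of x] False ext_above_antimono[of x "C k" A be]
        ext_above_antimono[of x "B k" A be] by (auto simp: c_def d_def N_def r_def s_def)
    then show ?thesis
      using share_cases dc rs k ctr_nonneg[of "d + N"] by (elim disjE) (auto simp: max_def)
  next
    case False
    then have ck: "c < k"
      using le_level_count_iff[OF B k, of x] by (simp add: c_def)
    then have "c + N \<le> s" "d + N \<le> s" "\<not> x < C k"
      using ext_above_antimono[of "B k" x A be] False dc le_level_count_iff[OF C k, of x]
      by (auto simp: N_def s_def d_def)
    moreover from this have "c + N \<le> r" "d + N \<le> r"
      using ext_above_antimono[of "C k" x A be] ck dc by (auto simp: N_def r_def)
    ultimately show ?thesis by (simp add: share_below)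
  qed
  have "level_count A (\<lambda>k. max (B k) (C k)) x = c" "level_count A (\<lambda>k. min (B k) (C k)) x = d"
    using level_count_max[OF B C] dc by (simp_all add: c_def d_def)
  moreover have "max (B k) (C k) = C k" "min (B k) (C k) = B k" using False by auto
  ultimately show ?thesis
    using goal by (simp add: seq_share_def seq_rank_def N_def c_def d_def r_def s_def)
qed

lemma seq_share_exchange:
  assumes B: "ladder A B" and C: "ladder A C" and k: "k \<in> cols"
  shows "seq_share be B k x + seq_share be C k x
    \<le> seq_share be (\<lambda>k. max (B k) (C k)) k x + seq_share be (\<lambda>k. min (B k) (C k)) k x"
proof (cases "level_count A C x \<le> level_count A B x")
  case True
  then show ?thesis by (rule seq_share_exchange_aux[OF assms])
next
  case False
  then have "level_count A B x \<le> level_count A C x" by simp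
  from seq_share_exchange_aux[OF C B k this] show ?thesis
    by (simp add: max.commute min.commute add.commute)
qed

text \<open>The rank at \<open>k\<close> depends on the own entry alone, so maximum and minimum
  merely permute the two values.\<close>

lemma clicks_exchange:
  "clicks (\<lambda>k. max (B k) (C k)) k + clicks (\<lambda>k. min (B k) (C k)) k = clicks B k + clicks C k"
  by (cases "B k \<le> C k") (simp_all add: clicks_def seq_rank_def max_def min_def)

text \<open>The click terms cancel, and shares, supermodular at each threshold, enter payments with
  a minus sign.\<close>

lemma price_exchange:
  assumes B: "ladder A B" and C: "ladder A C" and k: "k \<in> cols"
  shows "price (\<lambda>k. max (B k) (C k)) k + price (\<lambda>k. min (B k) (C k)) k \<le> price B k + price C k"
proof -
  have k1: "1 \<le> k" using k by simp
  let ?J = "\<lambda>k. max (B k) (C k)" let ?M = "\<lambda>k. min (B k) (C k)"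
  have "seq_pay be ?J k + seq_pay be ?M k \<le> seq_pay be B k + seq_pay be C k" for be
  proof -
    have "ctr A (seq_rank be ?J k) + ctr A (seq_rank be ?M k) = ctr A (seq_rank be B k) + ctr A (seq_rank be C k)"
      by (cases "B k \<le> C k") (simp_all add: seq_rank_def max_def min_def)
    then show ?thesis
      using seq_share_exchange[OF assms, of be]
      by (intro has_integral_le[OF has_integral_add[OF seq_pay_has_integral[OF k1] seq_pay_has_integral[OF k1]]
            has_integral_add[OF seq_pay_has_integral[OF k1] seq_pay_has_integral[OF k1]]])
         (smt (verit))
  qed
  then have "measure_pmf.expectation (ext_dist A) (\<lambda>be. seq_pay be ?J k + seq_pay be ?M k)
      \<le> measure_pmf.expectation (ext_dist A) (\<lambda>be. seq_pay be B k + seq_pay be C k)"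
    by (rule expectation_mono)
  then show ?thesis
    by (simp add: price_def integrable_ext_dist)
qed

end

section \<open>Rounding to left end points\<close>

text \<open>Halving raises the level by one and must stop at level \<open>bits A\<close>, where the
  width equals the threshold. End points thus lie on the grid of external bids; the reason for
  stopping is recorded too.\<close>

lemma rec_intervals_dyadic:
  assumes "(\<alpha>', \<beta>') \<in> rec_intervals A p \<alpha> \<beta>"
    and "\<alpha> = real k / 2 ^ j" "\<beta> = real (k + 1) / 2 ^ j" "j \<le> bits A"
  shows "\<exists>k' j'. j' \<le> bits A \<and> \<alpha>' = real k' / 2 ^ j' \<and> \<beta>' = real (k' + 1) / 2 ^ j' \<and>
           (ext_prob A \<alpha>' \<beta>' \<le> p \<or> \<beta>' - \<alpha>' \<le> 1 / 2 ^ bits A)"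
  using assms
proof (induction A p \<alpha> \<beta> arbitrary: k j rule: rec_intervals.induct)
  case (1 A p \<alpha> \<beta>)
  let ?stop = "ext_prob A \<alpha> \<beta> \<le> p \<or> \<beta> - \<alpha> \<le> 1 / 2 ^ bits A"
  show ?case
  proof (cases ?stop)
    case True
    then have "\<alpha>' = \<alpha>" "\<beta>' = \<beta>"
      using "1.prems"(1) by (auto simp: rec_intervals.simps[of A p \<alpha> \<beta>])
    then show ?thesis using True "1.prems" by blast
  next
    case False
    have "\<beta> - \<alpha> = 1 / 2 ^ j"
      using "1.prems" by (simp add: field_simps)
    then have "j \<noteq> bits A" using False by auto
    then have j: "Suc j \<le> bits A" using "1.prems"(4) by simp
    have ends: "\<alpha> = real (2 * k) / 2 ^ Suc j" "(\<alpha> + \<beta>) / 2 = real (2 * k + 1) / 2 ^ Suc j"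
      "\<beta> = real (2 * k + 1 + 1) / 2 ^ Suc j"
      using "1.prems" by (simp_all add: field_simps)
    have "(\<alpha>', \<beta>') \<in> rec_intervals A p \<alpha> ((\<alpha> + \<beta>) / 2) \<union> rec_intervals A p ((\<alpha> + \<beta>) / 2) \<beta>"
      using "1.prems"(1) False by (simp add: rec_intervals.simps[of A p \<alpha> \<beta>])
    then show ?thesis
      using "1.IH"(1)[OF False _ ends(1,2) j] "1.IH"(2)[OF False _ ends(2,3) j] by blast
  qed
qed

text \<open>Cells are closed on the left here, unlike in the recursion: a discretized bid at
  \<open>\<alpha>\<close> already beats external bids equal to \<open>\<alpha>\<close>, so a bid of
  exactly \<open>\<alpha>\<close> needs no rounding.\<close>

lemma rec_intervals_cover:
  assumes "\<alpha> \<le> x" "x < \<beta>"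
  shows "\<exists>(\<alpha>', \<beta>') \<in> rec_intervals A p \<alpha> \<beta>. \<alpha>' \<le> x \<and> x < \<beta>'"
  using assms
proof (induction A p \<alpha> \<beta> rule: rec_intervals.induct)
  case (1 A p \<alpha> \<beta>)
  show ?case
  proof (cases "ext_prob A \<alpha> \<beta> \<le> p \<or> \<beta> - \<alpha> \<le> 1 / 2 ^ bits A")
    case True
    then show ?thesis using "1.prems" by (simp add: rec_intervals.simps[of A p \<alpha> \<beta>])
  next
    case False
    then have eq: "rec_intervals A p \<alpha> \<beta> =
        rec_intervals A p \<alpha> ((\<alpha> + \<beta>) / 2) \<union> rec_intervals A p ((\<alpha> + \<beta>) / 2) \<beta>"
      by (simp add: rec_intervals.simps[of A p \<alpha> \<beta>])
    show ?thesis
    proof (cases "x < (\<alpha> + \<beta>) / 2")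
      case True
      then show ?thesis using "1.IH"(1)[OF False] "1.prems" unfolding eq by blast
    next
      case nless: False
      then have "(\<alpha> + \<beta>) / 2 \<le> x" by simp
      then show ?thesis using "1.IH"(2)[OF False] "1.prems" unfolding eq by blast
    qed
  qed
qed

text \<open>Provides 0 as a left end point and a last cell ending in 1.\<close>

lemma rec_intervals_ends:
  "(\<exists>\<beta>'. (\<alpha>, \<beta>') \<in> rec_intervals A p \<alpha> \<beta>) \<and> (\<exists>\<alpha>'. (\<alpha>', \<beta>) \<in> rec_intervals A p \<alpha> \<beta>)"
proof (induction A p \<alpha> \<beta> rule: rec_intervals.induct)
  case (1 A p \<alpha> \<beta>)
  show ?case
  proof (cases "ext_prob A \<alpha> \<beta> \<le> p \<or> \<beta> - \<alpha> \<le> 1 / 2 ^ bits A")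
    case True
    then show ?thesis by (simp add: rec_intervals.simps[of A p \<alpha> \<beta>])
  next
    case False
    then have eq: "rec_intervals A p \<alpha> \<beta> =
        rec_intervals A p \<alpha> ((\<alpha> + \<beta>) / 2) \<union> rec_intervals A p ((\<alpha> + \<beta>) / 2) \<beta>"
      by (simp add: rec_intervals.simps[of A p \<alpha> \<beta>])
    show ?thesis
      using "1.IH"(1)[OF False] "1.IH"(2)[OF False] unfolding eq by blast
  qed
qed

lemma rec_intervals_upper:
  assumes "(\<alpha>', \<beta>') \<in> rec_intervals A p \<alpha> \<beta>" "\<alpha> \<le> \<beta>"
  shows "\<beta>' \<le> \<beta>"
  using assms
proof (induction A p \<alpha> \<beta> rule: rec_intervals.induct)
  case (1 A p \<alpha> \<beta>)
  show ?case
  proof (cases "ext_prob A \<alpha> \<beta> \<le> p \<or> \<beta> - \<alpha> \<le> 1 / 2 ^ bits A")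
    case True
    then show ?thesis using "1.prems" by (simp add: rec_intervals.simps[of A p \<alpha> \<beta>])
  next
    case False
    then have "(\<alpha>', \<beta>') \<in> rec_intervals A p \<alpha> ((\<alpha> + \<beta>) / 2) \<or>
        (\<alpha>', \<beta>') \<in> rec_intervals A p ((\<alpha> + \<beta>) / 2) \<beta>"
      using "1.prems"(1) by (simp add: rec_intervals.simps[of A p \<alpha> \<beta>])
    moreover have "\<alpha> \<le> (\<alpha> + \<beta>) / 2" "(\<alpha> + \<beta>) / 2 \<le> \<beta>"
      using "1.prems"(2) by auto
    ultimately show ?thesis
      using "1.IH"(1)[OF False] "1.IH"(2)[OF False] order_trans by blast
  qed
qed

definition left_ends :: "auction \<Rightarrow> real \<Rightarrow> real set" where
  "left_ends A p = fst ` rec_intervals A p 0 1"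

definition round_down :: "auction \<Rightarrow> real \<Rightarrow> real \<Rightarrow> real" where
  "round_down A p x = Max {\<alpha> \<in> left_ends A p. \<alpha> \<le> x}"

lemma interval_props:
  assumes "(\<alpha>, \<beta>) \<in> rec_intervals A p 0 1"
  obtains k :: nat where "\<alpha> = real k / 2 ^ bits A" "0 \<le> \<alpha>" "\<alpha> < \<beta>" "\<beta> \<le> 1"
    "ext_prob A \<alpha> \<beta> \<le> p \<or> \<beta> - \<alpha> \<le> 1 / 2 ^ bits A"
proof -
  obtain k j where kj: "j \<le> bits A" "\<alpha> = real k / 2 ^ j" "\<beta> = real (k + 1) / 2 ^ j"
    and stop: "ext_prob A \<alpha> \<beta> \<le> p \<or> \<beta> - \<alpha> \<le> 1 / 2 ^ bits A"
    using rec_intervals_dyadic[OF assms, of 0 0] by auto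
  have "\<alpha> = real (k * 2 ^ (bits A - j)) / 2 ^ bits A"
  proof -
    have "(2::real) ^ bits A = 2 ^ (bits A - j) * 2 ^ j"
      using kj(1) by (simp add: power_add[symmetric])
    then show ?thesis unfolding kj(2) by simp
  qed
  moreover have "\<alpha> < \<beta>" using kj by (simp add: divide_strict_right_mono)
  moreover have "0 \<le> \<alpha>" using kj by simp
  moreover have "\<beta> \<le> 1"
    using rec_intervals_upper[OF assms] by simp
  ultimately show ?thesis using that stop by blast
qed

lemma finite_left_ends: "finite (left_ends A p)"
  by (simp add: left_ends_def finite_rec_intervals)

lemma zero_in_left_ends: "0 \<in> left_ends A p"
  using rec_intervals_ends[of 0 A p 1] by (force simp: left_ends_def)

lemma left_ends_bounds: "\<alpha> \<in> left_ends A p \<Longrightarrow> 0 \<le> \<alpha> \<and> \<alpha> \<le> 1"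
proof -
  assume "\<alpha> \<in> left_ends A p"
  then obtain \<beta> where "(\<alpha>, \<beta>) \<in> rec_intervals A p 0 1"
    by (auto simp: left_ends_def)
  then show ?thesis by (rule interval_props) linarith
qed

lemma round_down:
  assumes "0 \<le> x"
  shows "round_down A p x \<in> left_ends A p" "round_down A p x \<le> x"
proof -
  have "round_down A p x \<in> {\<alpha> \<in> left_ends A p. \<alpha> \<le> x}"
    unfolding round_down_def
  proof (rule Max_in)
    show "finite {\<alpha> \<in> left_ends A p. \<alpha> \<le> x}" using finite_left_ends[of A p] by simp
    show "{\<alpha> \<in> left_ends A p. \<alpha> \<le> x} \<noteq> {}" using zero_in_left_ends[of A p] assms by blast
  qed
  then show "round_down A p x \<in> left_ends A p" "round_down A p x \<le> x" by auto
qed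

lemma le_round_down: "\<alpha> \<in> left_ends A p \<Longrightarrow> \<alpha> \<le> x \<Longrightarrow> \<alpha> \<le> round_down A p x"
  unfolding round_down_def using finite_left_ends by (intro Max_ge) auto

lemma ladder_round_down:
  assumes "ladder A B"
  shows "ladder A (\<lambda>k. round_down A p (B k))"
  unfolding ladder_def
proof (intro conjI ballI impI)
  fix k assume k: "k \<in> {1..n_col A}"
  show "0 \<le> round_down A p (B k)" "round_down A p (B k) \<le> 1"
    using round_down[of "B k" A p] left_ends_bounds ladder_bounds[OF assms k] by blast+
  fix l assume "l \<in> {1..n_col A}" "k \<le> l"
  then have "B l \<le> B k" "0 \<le> B l"
    using ladder_le[OF assms k] ladder_bounds[OF assms] by auto
  then show "round_down A p (B l) \<le> round_down A p (B k)"
    using round_down[of "B l" A p] by (intro le_round_down) auto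
qed

text \<open>The profiles in which \<open>x\<close> beats an external bid that the rounded bid does
  not beat. External bids of 1 are left out because they may be frequent; they are handled in
  \<open>round_down_state\<close>.\<close>

definition missed :: "auction \<Rightarrow> real \<Rightarrow> real \<Rightarrow> (nat \<Rightarrow> real) set" where
  "missed A p x = {be. \<exists>j\<in>{1..n_ext A}. round_down A p x < be j \<and> be j \<le> x \<and> be j < 1}"

context ad_setting
begin

lemma prob_missed:
  assumes "0 \<le> x" "x \<le> 1" "0 \<le> p"
  shows "measure_pmf.prob (ext_dist A) (missed A p x) \<le> p"
proof -
  \<comment> \<open>No right-open cell contains \<open>x = 1\<close>, so the last cell, with
    \<open>\<beta> = 1\<close>, is taken. There the clause \<open>be j < 1\<close> in
    \<open>missed\<close> keeps the critical bids strictly inside the cell.\<close>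
  obtain \<alpha> \<beta> where I: "(\<alpha>, \<beta>) \<in> rec_intervals A p 0 1" and x: "\<alpha> \<le> x" "x < \<beta> \<or> \<beta> = 1"
  proof (cases "x < 1")
    case True
    then show ?thesis using rec_intervals_cover[of 0 x 1 A p] assms that by auto
  next
    case False
    then obtain \<alpha> where "(\<alpha>, 1) \<in> rec_intervals A p 0 1" using rec_intervals_ends by blast
    then show ?thesis using that[of \<alpha> 1] False by (auto elim: interval_props)
  qed
  obtain k :: nat where k: "\<alpha> = real k / 2 ^ bits A" "0 \<le> \<alpha>" "\<alpha> < \<beta>" "\<beta> \<le> 1"
    and stop: "ext_prob A \<alpha> \<beta> \<le> p \<or> \<beta> - \<alpha> \<le> 1 / 2 ^ bits A"
    using interval_props[OF I] by blast
  have "\<alpha> \<le> round_down A p x"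
    using I x by (intro le_round_down) (force simp: left_ends_def)+
  then have sub: "\<alpha> < be j \<and> be j < \<beta> \<or> x < \<beta> \<and> \<alpha> < be j \<and> be j \<le> x"
    if "round_down A p x < be j \<and> be j \<le> x \<and> be j < 1" for be :: "nat \<Rightarrow> real" and j
    using that x by auto
  from stop show ?thesis
  proof
    assume "ext_prob A \<alpha> \<beta> \<le> p"
    moreover have "missed A p x \<subseteq> {be. \<exists>j\<in>{1..n_ext A}. be j \<in> {\<alpha><..\<beta>}}"
      unfolding missed_def using sub by fastforce
    then have "measure_pmf.prob (ext_dist A) (missed A p x) \<le> ext_prob A \<alpha> \<beta>"
      unfolding ext_prob_def by (intro measure_pmf.finite_measure_mono) auto
    ultimately show ?thesis by linarith
  next
    \<comment> \<open>Since \<open>\<alpha>\<close> is a grid point, the open cell contains no grid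
      point and hence no possible external bid.\<close>
    assume narrow: "\<beta> - \<alpha> \<le> 1 / 2 ^ bits A"
    have "be \<notin> missed A p x" if be: "be \<in> ext_profiles A" for be
    proof
      assume "be \<in> missed A p x"
      then obtain j where j: "j \<in> {1..n_ext A}" "\<alpha> < be j" "be j < \<beta>"
        unfolding missed_def using sub by fastforce
      obtain m :: nat where m: "be j = real m / 2 ^ bits A"
        using PiE_mem[OF be[unfolded ext_profiles_def] j(1)] by auto
      have "real k < real m"
        using j(2) unfolding m k(1) by (simp add: divide_less_cancel)
      moreover have "be j < \<alpha> + 1 / 2 ^ bits A" using j(3) narrow by linarith
      then have "real m / 2 ^ bits A < (real k + 1) / 2 ^ bits A"
        unfolding m k(1) by (simp add: add_divide_distrib)
      then have "real m < real (k + 1)"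
        by (simp add: divide_less_cancel)
      ultimately show False unfolding of_nat_less_iff by simp
    qed
    then have "set_pmf (ext_dist A) \<inter> missed A p x = {}"
      using ext_dist_profiles by blast
    then have "measure_pmf.prob (ext_dist A) (missed A p x) = 0"
      by (simp add: measure_pmf_zero_iff)
    then show ?thesis using assms by simp
  qed
qed

end

section \<open>The rearrangement inequality\<close>

lemma sum_bij_image:
  fixes g :: "nat \<Rightarrow> real"
  assumes "bij_betw P I {1..m}"
  shows "(\<Sum>i\<in>I. g (P i)) = (\<Sum>k = 1..m. g k)"
  using sum.reindex_bij_betw[OF assms] .

text \<open>Abel summation writes \<open>f\<close> as a constant plus a nonnegative combination of
  indicators of initial segments. It then suffices that the first \<open>j\<close> places under
  \<open>Q\<close> carry at least the weight of those under \<open>P\<close>.\<close>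

lemma rearrangement:
  fixes w :: "'a \<Rightarrow> real" and f :: "nat \<Rightarrow> real"
  assumes P: "bij_betw P I {1..m}" and Q: "bij_betw Q I {1..m}"
    and w: "\<And>i j. \<lbrakk>i \<in> I; j \<in> I; Q i \<le> Q j\<rbrakk> \<Longrightarrow> w j \<le> w i"
    and f: "\<And>k l. \<lbrakk>1 \<le> k; k \<le> l; l \<le> m\<rbrakk> \<Longrightarrow> f l \<le> f k"
  shows "(\<Sum>i\<in>I. w i * f (P i)) \<le> (\<Sum>i\<in>I. w i * f (Q i))"
proof -
  define top :: "('a \<Rightarrow> nat) \<Rightarrow> nat \<Rightarrow> real" where
    "top R j = (\<Sum>i\<in>I. (if R i \<le> j then 1 else 0) * w i)" for R j
  have abel: "f k = f m + (\<Sum>j = 1..<m. (f j - f (Suc j)) * (if k \<le> j then 1 else 0))"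
    if "1 \<le> k" "k \<le> m" for k
  proof -
    have "(\<Sum>j = 1..<m. (f j - f (Suc j)) * (if k \<le> j then 1 else 0)) = (\<Sum>j = k..<m. f j - f (Suc j))"
      using that by (intro sum.mono_neutral_cong_right) auto
    also have "\<dots> = f k - f m"
      using sum_Suc_diff'[OF that(2), of "\<lambda>j. - f j"] by simp
    finally show ?thesis by simp
  qed
  have expand: "(\<Sum>i\<in>I. w i * f (R i))
      = (\<Sum>i\<in>I. w i) * f m + (\<Sum>j = 1..<m. (f j - f (Suc j)) * top R j)"
    if R: "bij_betw R I {1..m}" for R
  proof -
    have "(\<Sum>i\<in>I. w i * f (R i)) = (\<Sum>i\<in>I. w i * f m +
        (\<Sum>j = 1..<m. (f j - f (Suc j)) * ((if R i \<le> j then 1 else 0) * w i)))"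
    proof (rule sum.cong[OF refl])
      fix i assume "i \<in> I"
      then have "R i \<in> {1..m}" using bij_betw_apply[OF R] by blast
      then have "f (R i) = f m + (\<Sum>j = 1..<m. (f j - f (Suc j)) * (if R i \<le> j then 1 else 0))"
        by (intro abel) auto
      then have "w i * f (R i)
          = w i * f m + w i * (\<Sum>j = 1..<m. (f j - f (Suc j)) * (if R i \<le> j then 1 else 0))"
        by (simp only: distrib_left)
      then show "w i * f (R i) = w i * f m +
          (\<Sum>j = 1..<m. (f j - f (Suc j)) * ((if R i \<le> j then 1 else 0) * w i))"
        by (simp only: sum_distrib_left mult.assoc mult.left_commute mult.commute)
    qed
    also have "\<dots> = (\<Sum>i\<in>I. w i * f m) +
        (\<Sum>j = 1..<m. \<Sum>i\<in>I. (f j - f (Suc j)) * ((if R i \<le> j then 1 else 0) * w i))"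
      by (simp only: sum.distrib) (subst sum.swap, rule refl)
    finally show ?thesis
      by (simp only: top_def sum_distrib_left sum_distrib_right)
  qed
  have "top P j \<le> top Q j" if j: "j \<in> {1..<m}" for j
  proof -
    have "j \<in> Q ` I" using j bij_betw_imp_surj_on[OF Q] by simp
    then obtain i0 where i0: "i0 \<in> I" "Q i0 = j" by blast
    have count: "(\<Sum>i\<in>I. if R i \<le> j then 1 else 0 :: real) = real j" if "bij_betw R I {1..m}" for R
    proof -
      have "(\<Sum>i\<in>I. if R i \<le> j then 1 else 0 :: real) = (\<Sum>k = 1..m. if k \<le> j then 1 else 0)"
        using sum_bij_image[OF that, of "\<lambda>k. if k \<le> j then 1 else 0"] .
      also have "\<dots> = (\<Sum>k = 1..j. 1)"
        using j by (intro sum.mono_neutral_cong_right) auto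
      finally show ?thesis by simp
    qed
    \<comment> \<open>Both orders put exactly \<open>j\<close> elements on top, so subtracting the
      weight \<open>w i0\<close> at place \<open>j\<close> of \<open>Q\<close> does not affect the
      comparison. Afterwards \<open>Q\<close> collects every positive term and no negative
      one.\<close>
    have split: "top R j = (\<Sum>i\<in>I. (if R i \<le> j then 1 else 0) * (w i - w i0)) + real j * w i0"
      if "bij_betw R I {1..m}" for R
      unfolding top_def count[OF that, symmetric] sum_distrib_right sum.distrib[symmetric]
      by (rule sum.cong[OF refl]) (simp add: algebra_simps)
    have "(if P i \<le> j then 1 else 0) * (w i - w i0) \<le> (if Q i \<le> j then 1 else 0) * (w i - w i0)"
      if "i \<in> I" for i
      using w[OF that i0(1)] w[OF i0(1) that] i0(2) by auto
    then show ?thesis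
      unfolding split[OF P] split[OF Q] by (intro add_mono sum_mono) auto
  qed
  moreover have "0 \<le> f j - f (Suc j)" if "j \<in> {1..<m}" for j
    using f[of j "Suc j"] that by simp
  ultimately show ?thesis
    unfolding expand[OF P] expand[OF Q] by (intro add_left_mono sum_mono mult_left_mono) auto
qed

section \<open>The loss from rounding a ladder down\<close>

context ad_setting
begin

lemma level_count_mono:
  assumes "\<And>l. l \<in> cols \<Longrightarrow> C l \<le> B l"
  shows "level_count A C x \<le> level_count A B x"
  unfolding level_count_def
proof (rule card_mono)
  show "{k \<in> cols. x < C k} \<subseteq> {k \<in> cols. x < B k}"
    using assms by (auto intro: less_le_trans)
qed simp

lemma seq_pay_mono:
  assumes "1 \<le> k" "k \<in> cols" "\<And>l. l \<in> cols \<Longrightarrow> C l \<le> B l"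
  shows "seq_pay be C k \<le> seq_pay be B k"
proof (rule has_integral_le[OF seq_pay_has_integral[OF assms(1)] seq_pay_has_integral[OF assms(1)]])
  fix x
  have "seq_rank be B k \<le> seq_rank be C k" "1 \<le> seq_rank be B k"
    using assms by (simp_all add: seq_rank_def ext_above_antimono)
  then show "ctr A (seq_rank be C k) - seq_share be C k x \<le> ctr A (seq_rank be B k) - seq_share be B k x"
    unfolding seq_share_def using level_count_mono[OF assms(3)]
    by (intro pay_rate_mono) auto
qed

text \<open>In a missed state the loss is at most 1, because \<open>w \<le> 1\<close> and payments
  do not rise. Otherwise the rank is kept if \<open>B k < 1\<close>; if \<open>B k = 1\<close>,
  clicks are lost only to external bids of 1, and these clicks were bought at price 1.\<close>

lemma round_down_state:
  fixes p :: real
  assumes B: "ladder A B" and k: "k \<in> cols" and w: "0 \<le> w" "w \<le> 1" and be: "be \<in> ext_profiles A"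
  defines "C \<equiv> \<lambda>k. round_down A p (B k)"
  shows "w * ctr A (seq_rank be B k) - seq_pay be B k - indicator (missed A p (B k)) be
    \<le> w * ctr A (seq_rank be C k) - seq_pay be C k"
proof -
  have k1: "1 \<le> k" using k by simp
  have CB: "C l \<le> B l" if "l \<in> cols" for l
    using round_down(2)[of "B l" A p] ladder_bounds[OF B that] by (simp add: C_def)
  have pay: "seq_pay be C k \<le> seq_pay be B k"
    by (rule seq_pay_mono[OF k1 k CB])
  let ?r = "seq_rank be B k" and ?r' = "seq_rank be C k"
  have rr: "?r \<le> ?r'"
    using CB[OF k] by (simp add: seq_rank_def ext_above_antimono)
  show ?thesis
  proof (cases "be \<in> missed A p (B k)")
    case True
    have "w * ctr A ?r \<le> 1" "0 \<le> w * ctr A ?r'"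
      using ctr_seq_rank_bounds[OF k1, of be B] ctr_seq_rank_bounds[OF k1, of be C] w
      by (auto simp: mult_le_one)
    then show ?thesis using True pay by simp
  next
    case False
    then have nm: "1 \<le> be j" if "j \<in> {1..n_ext A}" "C k < be j" "be j \<le> B k" for j
      using that by (force simp: missed_def C_def)
    show ?thesis
    proof (cases "B k < 1")
      case True
      have "C k < be j \<longleftrightarrow> B k < be j" if "j \<in> {1..n_ext A}" for j
        using nm[OF that] True CB[OF k] by linarith
      then have "{j \<in> {1..n_ext A}. C k < be j} = {j \<in> {1..n_ext A}. B k < be j}"
        by blast
      then have "?r' = ?r" by (simp add: seq_rank_def ext_above_def)
      then show ?thesis using pay False by simp
    next
      case one: False
      then have Bk: "B k = 1" using ladder_bounds[OF B k] by simp
      have be1: "be j \<le> 1" if "j \<in> {1..n_ext A}" for j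
        using ext_bid_bounds[OF be that] by simp
      have "{j \<in> {1..n_ext A}. 1 < be j} = {}"
      proof (intro equals0I)
        fix j assume "j \<in> {j \<in> {1..n_ext A}. 1 < be j}"
        then show False using be1[of j] by simp
      qed
      then have r: "?r = k" by (simp add: seq_rank_def ext_above_def Bk)
      have ext: "ext_above A be (C k) \<le> ext_above A be x" if "x < 1" for x
        unfolding ext_above_def
      proof (rule card_mono)
        show "{j \<in> {1..n_ext A}. C k < be j} \<subseteq> {j \<in> {1..n_ext A}. x < be j}"
        proof
          fix j assume j: "j \<in> {j \<in> {1..n_ext A}. C k < be j}"
          then have "1 \<le> be j" using nm[of j] be1[of j] Bk by simp
          then show "j \<in> {j \<in> {1..n_ext A}. x < be j}" using j that by simp
        qed
      qed simp
      \<comment> \<open>All external bids above \<open>C k\<close> equal 1 and count at every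
        threshold below 1. Lost clicks were therefore charged at each of them, and the share, which
        is the surplus at value 1 per click, does not shrink.\<close>
      have le: "seq_share be B k x \<le> seq_share be C k x" if "x < 1" for x
      proof -
        let ?n = "level_count A B x + ext_above A be x" and ?n' = "level_count A C x + ext_above A be x"
        have "k \<le> level_count A B x"
          using le_level_count_iff[OF B k, of x] Bk that by simp
        then have "?r' \<le> ?n" using ext[OF that] by (simp add: seq_rank_def)
        moreover have "?n' \<le> ?n" using level_count_mono[OF CB] by simp
        ultimately show ?thesis
          unfolding seq_share_def r using share_cases rr r k1 ctr_nonneg[of ?r']
          by (elim disjE) (auto simp: intro: ctr_antimono)
      qed
      have "integral {0..1} (seq_share be B k)
          = integral {0..1} (\<lambda>x. if x = 1 then seq_share be C k x else seq_share be B k x)"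
        by (rule integral_spike[of "{1}"]) auto
      also have "\<dots> \<le> integral {0..1} (seq_share be C k)"
      proof (rule integral_le)
        show "(\<lambda>x. if x = 1 then seq_share be C k x else seq_share be B k x) integrable_on {0..1}"
          by (rule integrable_spike[OF seq_share_integrable[OF k1, of be B], of "{1}"]) auto
        show "seq_share be C k integrable_on {0..1}" by (rule seq_share_integrable[OF k1])
      qed (use le in auto)
      finally have "integral {0..1} (seq_share be B k) \<le> integral {0..1} (seq_share be C k)" .
      \<comment> \<open>At value \<open>w\<close> the surplus is the integral of the share minus
        \<open>(1 - w)\<close> times the clicks; this is where \<open>w \<le> 1\<close>
        enters.\<close>
      moreover have "(1 - w) * ctr A ?r' \<le> (1 - w) * ctr A ?r"
        using rr k1 w by (intro mult_left_mono ctr_antimono) (auto simp: seq_rank_def)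
      ultimately show ?thesis
        using False by (simp add: seq_pay_def algebra_simps)
    qed
  qed
qed

lemma round_down_loss:
  fixes p :: real
  assumes B: "ladder A B" and k: "k \<in> cols" and w: "0 \<le> w" "w \<le> 1" and p: "0 \<le> p"
  defines "C \<equiv> \<lambda>k. round_down A p (B k)"
  shows "w * clicks B k - price B k - p \<le> w * clicks C k - price C k"
proof -
  have "measure_pmf.expectation (ext_dist A) (\<lambda>be. w * ctr A (seq_rank be B k) - seq_pay be B k -
        indicator (missed A p (B k)) be)
      \<le> measure_pmf.expectation (ext_dist A) (\<lambda>be. w * ctr A (seq_rank be C k) - seq_pay be C k)"
    unfolding C_def by (rule expectation_mono) (rule round_down_state[OF B k w])
  then have "w * clicks B k - price B k - measure_pmf.prob (ext_dist A) (missed A p (B k))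
      \<le> w * clicks C k - price C k"
    by (simp add: clicks_def price_def integrable_ext_dist)
  moreover have "measure_pmf.prob (ext_dist A) (missed A p (B k)) \<le> p"
    using ladder_bounds[OF B k] p by (intro prob_missed) auto
  ultimately show ?thesis by linarith
qed

end

section \<open>Weighted revenue minus payments\<close>

text \<open>Every position up to that of an element of \<open>T\<close> is held by an element of
  \<open>T\<close>; counting them bounds the position by \<open>card T\<close>.\<close>

lemma bij_betw_initial_segment:
  fixes P :: "nat \<Rightarrow> nat"
  assumes P: "bij_betw P C {1..n}" and T: "T \<subseteq> C"
    and first: "\<And>i j. \<lbrakk>i \<in> T; j \<in> C - T\<rbrakk> \<Longrightarrow> P i < P j"
  shows "bij_betw P T {1..card T}"
proof -
  have inj: "inj_on P T"
    using bij_betw_imp_inj_on[OF P] T by (rule inj_on_subset)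
  have fin: "finite (P ` T)"
    using bij_betw_imp_surj_on[OF P] T by (metis finite_atLeastAtMost finite_subset image_mono)
  have "P i \<in> {1..card T}" if i: "i \<in> T" for i
  proof -
    have Pi: "P i \<in> {1..n}" using bij_betw_apply[OF P] T i by blast
    have "l \<in> P ` T" if l: "l \<in> {1..P i}" for l
    proof -
      have "l \<in> P ` C" using bij_betw_imp_surj_on[OF P] l Pi by simp
      then obtain j where j: "j \<in> C" "l = P j" by blast
      then have "j \<in> T" using first[OF i, of j] l by (cases "j \<in> T") auto
      then show ?thesis using j by blast
    qed
    then have "card {1..P i} \<le> card (P ` T)"
      using fin by (intro card_mono) auto
    then show ?thesis using Pi card_image[OF inj] by simp
  qed
  then have "P ` T \<subseteq> {1..card T}" by blast
  then have "P ` T = {1..card T}"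
    by (intro card_subset_eq) (simp_all add: card_image[OF inj])
  then show ?thesis using inj by (simp add: bij_betw_def)
qed

context ad_setting
begin

text \<open>At a bid of 0, the bids above any nonnegative threshold number fewer than the own rank,
  so nothing is charged.\<close>

lemma price_bottom:
  assumes "ladder A B" "k \<in> cols" "B k = 0"
  shows "price B k = 0"
proof -
  have "seq_pay be B k = 0" for be
  proof -
    have "ctr A (seq_rank be B k) - seq_share be B k x = 0" if "x \<in> {0..1}" for x
    proof -
      have "level_count A B x < k"
        using le_level_count_iff[OF assms(1,2), of x] assms(3) that by simp
      moreover have "ext_above A be x \<le> ext_above A be 0"
        using that by (intro ext_above_antimono) simp
      ultimately show ?thesis
        by (simp add: seq_share_def seq_rank_def assms(3) share_below)
    qed
    then have "((\<lambda>x. ctr A (seq_rank be B k) - seq_share be B k x) has_integral 0) {0..1}"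
      by (rule has_integral_is_0)
    moreover have "1 \<le> k" using assms(2) by simp
    ultimately show ?thesis
      using seq_pay_has_integral has_integral_unique by blast
  qed
  then show ?thesis by (simp add: price_def)
qed

text \<open>The colluders in \<open>T\<close> keep their bids and their mutual order, all others drop to \<open>0\<close>; a member
  of \<open>T\<close> whose clicks are worth at least \<open>1\<close>, hence at least any price, can only gain.\<close>

lemma concentrate:
  assumes P: "bij_betw P cols cols" and B: "ladder A B" and T: "T \<subseteq> cols"
  obtains P' B' where "bij_betw P' cols cols" "ladder A B'" "\<And>k. k \<in> cols \<Longrightarrow> B' k \<in> insert 0 (B ` cols)"
    "bij_betw P' T {1..card T}" "\<And>k. \<lbrakk>k \<in> cols; card T < k\<rbrakk> \<Longrightarrow> B' k = 0"
    "\<And>i a. \<lbrakk>i \<in> T; 1 \<le> a\<rbrakk> \<Longrightarrow>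
       a * clicks B (P i) - price B (P i) \<le> a * clicks B' (P' i) - price B' (P' i)"
proof -
  \<comment> \<open>Tie-breakers are at least 1 on \<open>T\<close> and 0 elsewhere, so
    \<open>T\<close> stays ahead even at a common bid of 0.\<close>
  define bc :: strategy where
    "bc i = (if i \<in> T then (B (P i), n_col A + 1 - P i) else (0, 0))" for i
  define P' where "P' = place A bc"
  define B' where "B' k = fst (bc (inv_into cols P' k))" for k
  have PC: "P i \<in> cols" if "i \<in> cols" for i
    using bij_betw_apply[OF P that] .
  have inj: "P i = P j \<longleftrightarrow> i = j" if "i \<in> cols" "j \<in> cols" for i j
    using inj_on_eq_iff[OF bij_betw_imp_inj_on[OF P] that] .
  have Bb: "0 \<le> B (P i)" "B (P i) \<le> 1" if "i \<in> cols" for i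
    using ladder_bounds[OF B PC[OF that]] by auto
  have "0 \<le> fst (bc i) \<and> fst (bc i) \<le> 1" if "i \<in> cols" for i
    using Bb[OF that] by (simp add: bc_def)
  from placed_exists[of A bc, OF this]
  have pl: "placed A bc P' B'"
    unfolding P'_def B'_def by simp
  then have P': "bij_betw P' cols cols" and B': "ladder A B'"
    and bcB': "\<And>i. i \<in> cols \<Longrightarrow> fst (bc i) = B' (P' i)"
    by (simp_all add: placed_def)
  have surj: "\<exists>i \<in> cols. P' i = k" if "k \<in> cols" for k
  proof -
    have "k \<in> P' ` cols" using that bij_betw_imp_surj_on[OF P'] by simp
    then show ?thesis by blast
  qed
  have pl0: "placed A (seq_strategy A P B) P B"
    by (rule placed_seq_strategy[OF P B])
  have TO: "P' i < P' j" if "i \<in> T" "j \<in> cols - T" for i j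
  proof -
    have "i \<in> cols" using T that by blast
    then have "0 \<le> B (P i)" "P i \<le> n_col A" using Bb PC by auto
    then have "ranked_above bc (\<lambda>_. 0) (Colluder i) (Colluder j)"
      using that by (auto simp: bc_def)
    then show ?thesis
      unfolding P'_def by (rule place_less[OF \<open>i \<in> cols\<close>])
  qed
  have TT: "P' i < P' j \<longleftrightarrow> P i < P j" if ij: "i \<in> T" "j \<in> T" for i j
  proof -
    have less: "P' i < P' j" if ij: "i \<in> T" "j \<in> T" "P i < P j" for i j
    proof -
      have C: "i \<in> cols" "j \<in> cols" using T ij by auto
      have "B (P j) \<le> B (P i)"
        using ij PC C by (intro ladder_le[OF B]) auto
      moreover have "n_col A + 1 - P j < n_col A + 1 - P i"
        using ij PC[OF C(2)] by auto
      ultimately have "ranked_above bc (\<lambda>_. 0) (Colluder i) (Colluder j)"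
        using ij(1,2) by (auto simp: bc_def)
      then show ?thesis
        unfolding P'_def by (rule place_less[OF C(1)])
    qed
    have "i \<in> cols" "j \<in> cols" using T ij by auto
    then show ?thesis
      using less[OF ij] less[OF ij(2,1)] inj[of i j] by (cases "P i" "P j" rule: linorder_cases) auto
  qed
  have BT: "B' (P' i) = B (P i)" if "i \<in> T" for i
    using bcB'[of i] T that by (auto simp: bc_def)
  have BO: "B' (P' i) = 0" if "i \<in> cols - T" for i
    using bcB'[of i] that by (auto simp: bc_def)
  have P'T: "bij_betw P' T {1..card T}"
    by (rule bij_betw_initial_segment[OF P' T TO])
  have top: "i \<in> T" if "i \<in> cols" "P' i \<le> card T" for i
  proof (rule ccontr)
    assume "i \<notin> T"
    have "P' i \<in> P' ` T"
      using that bij_betw_imp_surj_on[OF P'T] bij_betw_apply[OF P' that(1)] by simp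
    then obtain j where "j \<in> T" "P' j = P' i" by auto
    then show False using TO[of j i] \<open>i \<notin> T\<close> that by simp
  qed
  \<comment> \<open>Whoever is ahead of \<open>i\<close> in the new order lies in \<open>T\<close>
    and was ahead of \<open>i\<close> before.\<close>
  have P'le: "P' i \<le> P i" if i: "i \<in> T" for i
  proof -
    have iC: "i \<in> cols" using i T by blast
    have sub: "{j \<in> cols. P' j < P' i} \<subseteq> {j \<in> cols. P j < P i}"
    proof
      fix j assume j: "j \<in> {j \<in> cols. P' j < P' i}"
      then have "j \<in> T" using TO[OF i, of j] by auto
      then show "j \<in> {j \<in> cols. P j < P i}" using j TT[of j i] i by auto
    qed
    have "R i = card {j \<in> cols. R j < R i} + 1" if "placed A c R D" for c R D
    proof -
      have R: "\<And>j. j \<in> cols \<Longrightarrow> place A c j = R j" using that by (simp add: placed_def)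
      have "{j \<in> cols. ranked_above c (\<lambda>_. 0) (Colluder j) (Colluder i)} = {j \<in> cols. R j < R i}"
        using place_less_iff[OF iC, of _ c] R iC by auto
      then show ?thesis using R[OF iC] by (simp add: place_def)
    qed
    from this[OF pl] this[OF pl0] show ?thesis
      using card_mono[OF _ sub] by simp
  qed
  have cc: "level_count A B' x \<le> level_count A B x" if "0 \<le> x" for x
    unfolding placed_col_above[OF pl, symmetric] placed_col_above[OF pl0, symmetric] col_above_def
  proof (rule card_mono)
    show "{i \<in> cols. x < fst (bc i)} \<subseteq> {i \<in> cols. x < fst (seq_strategy A P B i)}"
      using that by (auto simp: bc_def seq_strategy_def split: if_splits)
  qed simp
  have gain: "a * ctr A (seq_rank be B (P i)) - seq_pay be B (P i)
      \<le> a * ctr A (seq_rank be B' (P' i)) - seq_pay be B' (P' i)"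
    if i: "i \<in> T" and a: "1 \<le> a" for i a be
  proof -
    have iC: "i \<in> cols" using i T by blast
    have k: "P i \<in> cols" "P' i \<in> cols" using PC[OF iC] bij_betw_apply[OF P' iC] by auto
    then have k1: "1 \<le> P i" "1 \<le> P' i" by auto
    let ?y = "B (P i)" and ?r = "seq_rank be B (P i)" and ?r' = "seq_rank be B' (P' i)"
    have rr: "?r' \<le> ?r" using P'le[OF i] by (simp add: seq_rank_def BT[OF i])
    have r1: "1 \<le> ?r'" "1 \<le> ?r" using k1 by (simp_all add: seq_rank_def)
    have "seq_share be B (P i) x \<le> seq_share be B' (P' i) x" if x: "x \<in> {0..1}" for x
    proof -
      let ?n = "level_count A B x + ext_above A be x" and ?n' = "level_count A B' x + ext_above A be x"
      have nn: "?n' \<le> ?n" using cc x by simp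
      \<comment> \<open>This settles GSP: a bid ranked below \<open>i\<close> and above the
        threshold under \<open>B'\<close> has a counterpart under \<open>B\<close>. If it is not
        external, the next colluder provides it, who lies in \<open>T\<close> and stood below
        \<open>i\<close> before as well.\<close>
      have "?r < ?n" if big: "?r' < ?n'"
      proof (cases "x < ?y")
        case False
        then have "level_count A B' x < P' i" "ext_above A be x \<le> ext_above A be ?y"
          using le_level_count_iff[OF B' k(2), of x] BT[OF i] by (auto intro: ext_above_antimono)
        then show ?thesis using big by (simp add: seq_rank_def BT[OF i])
      next
        case True
        have N: "ext_above A be ?y \<le> ext_above A be x"
          using True by (intro ext_above_antimono) simp
        have c: "P i \<le> level_count A B x"
          using le_level_count_iff[OF B k(1), of x] True by simp
        show ?thesis
        proof (cases "ext_above A be x = ext_above A be ?y")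
          case False
          then show ?thesis using N c by (simp add: seq_rank_def)
        next
          case eq: True
          then have k': "Suc (P' i) \<le> level_count A B' x"
            using big by (simp add: seq_rank_def BT[OF i])
          then have k'C: "Suc (P' i) \<in> cols"
            using level_count_le[of A B' x] by simp
          then have "x < B' (Suc (P' i))"
            using le_level_count_iff[OF B' k'C, of x] k' by simp
          moreover obtain j where j: "j \<in> cols" "P' j = Suc (P' i)" using surj[OF k'C] by blast
          ultimately have jT: "j \<in> T" and xj: "x < B (P j)"
            using BO[of j] BT[of j] x by (cases "j \<in> T"; simp)+
          have "P i < P j" using TT[OF i jT] j by simp
          moreover have "P j \<le> level_count A B x"
            using le_level_count_iff[OF B PC[OF j(1)], of x] xj by simp
          ultimately show ?thesis using eq by (simp add: seq_rank_def)
        qed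
      qed
      moreover have "ctr A (max ?r ?n) \<le> ctr A (max ?r' ?n')"
        using nn rr r1 by (intro ctr_antimono max.mono) auto
      moreover have "ctr A ?r \<le> ctr A ?r'"
        using rr r1 by (intro ctr_antimono)
      ultimately show ?thesis
        unfolding seq_share_def using share_cases r1 ctr_nonneg[of ?r']
        by (elim disjE) (auto simp: not_less)
    qed
    then have "integral {0..1} (seq_share be B (P i)) \<le> integral {0..1} (seq_share be B' (P' i))"
      by (intro integral_le seq_share_integrable k1)
    \<comment> \<open>The surplus is \<open>(a - 1)\<close> times the clicks plus the integral of
      the share; for \<open>a \<ge> 1\<close> neither term falls.\<close>
    moreover have "(a - 1) * ctr A ?r \<le> (a - 1) * ctr A ?r'"
      using a rr r1 by (intro mult_left_mono ctr_antimono) auto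
    ultimately show ?thesis
      by (simp add: seq_pay_def algebra_simps)
  qed
  have "a * clicks B (P i) - price B (P i) \<le> a * clicks B' (P' i) - price B' (P' i)"
    if "i \<in> T" "1 \<le> a" for i a
  proof -
    have "measure_pmf.expectation (ext_dist A) (\<lambda>be. a * ctr A (seq_rank be B (P i)) - seq_pay be B (P i))
      \<le> measure_pmf.expectation (ext_dist A) (\<lambda>be. a * ctr A (seq_rank be B' (P' i)) - seq_pay be B' (P' i))"
      by (rule expectation_mono) (rule gain[OF that])
    then show ?thesis by (simp add: clicks_def price_def integrable_ext_dist)
  qed
  moreover have "B' k \<in> insert 0 (B ` cols)" if k: "k \<in> cols" for k
  proof -
    obtain i where "i \<in> cols" "P' i = k" using surj[OF k] by blast
    then show ?thesis using BT[of i] BO[of i] PC[of i] by (cases "i \<in> T") auto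
  qed
  moreover have "B' k = 0" if k: "k \<in> cols" "card T < k" for k
  proof -
    obtain i where i: "i \<in> cols" "P' i = k" using surj[OF k(1)] by blast
    then have "i \<notin> T" using bij_betw_apply[OF P'T, of i] k by auto
    then show ?thesis using BO[of i] i by simp
  qed
  ultimately show ?thesis
    using that P' B' P'T by blast
qed

section \<open>Scores of discretized ladders\<close>

definition disc_ladder :: "real \<Rightarrow> (nat \<Rightarrow> real) \<Rightarrow> bool" where
  "disc_ladder p B \<longleftrightarrow> ladder A B \<and> (\<forall>k\<in>cols. B k \<in> left_ends A p)"

definition score :: "(nat \<Rightarrow> real) \<Rightarrow> (nat \<Rightarrow> nat) \<Rightarrow> (nat \<Rightarrow> real) \<Rightarrow> real" where
  "score a P B = (\<Sum>i\<in>cols. a i * val A i * clicks B (P i) - price B (P i))"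

lemma val_bounds: "i \<in> cols \<Longrightarrow> 0 \<le> val A i \<and> val A i \<le> 1"
  using ad unfolding ad_auction_def by blast

lemma disc_ladder_max:
  assumes "disc_ladder p B" "disc_ladder p C"
  shows "disc_ladder p (\<lambda>k. max (B k) (C k))"
  using assms ladder_max(1)[of B C] by (simp add: disc_ladder_def max_def)

lemma sum_price_bij:
  "bij_betw P I {1..m} \<Longrightarrow> bij_betw Q I {1..m} \<Longrightarrow>
   (\<Sum>i\<in>I. price B (P i)) = (\<Sum>i\<in>I. price B (Q i))"
  by (simp only: sum_bij_image)

lemma clicks_ladder_antimono:
  assumes "ladder A B" "1 \<le> k" "k \<le> l" "l \<le> n_col A"
  shows "clicks B l \<le> clicks B k"
  using assms by (intro clicks_mono ladder_le[OF assms(1)]) auto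

text \<open>Permuting the colluders on a fixed ladder leaves the sum of prices unchanged, so only
  revenues are rearranged.\<close>

lemma score_sort:
  assumes P: "bij_betw P cols cols" and Q: "bij_betw Q cols cols" and B: "ladder A B"
    and w: "\<And>i j. \<lbrakk>i \<in> cols; j \<in> cols; Q i \<le> Q j\<rbrakk> \<Longrightarrow> a j * val A j \<le> a i * val A i"
  shows "score a P B \<le> score a Q B"
proof -
  have "(\<Sum>i\<in>cols. a i * val A i * clicks B (P i)) \<le> (\<Sum>i\<in>cols. a i * val A i * clicks B (Q i))"
    by (rule rearrangement[OF P Q w clicks_ladder_antimono[OF B]])
  then show ?thesis
    unfolding score_def sum_subtractf using sum_price_bij[OF P Q, of B] by linarith
qed

text \<open>The weights \<open>a\<close> exceed the weights \<open>a'\<close> by the factor \<open>s\<close> on \<open>T\<close>. Either \<open>B'\<close> already gives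
  \<open>T\<close> enough weighted revenue, or raising it to the join with the bids that \<open>T\<close> uses in \<open>B\<^sub>1\<close> helps,
  because payments are submodular.\<close>

lemma score_raise:
  fixes a a' c :: "nat \<Rightarrow> real" and s p :: real
  assumes a1: "\<And>i. i \<in> cols \<Longrightarrow> 1 \<le> a i"
    and T: "T = {i \<in> cols. 1 < a i * val A i}" and s: "1 \<le> s"
    and a': "\<And>i. i \<in> T \<Longrightarrow> a i = s * a' i" "\<And>i. i \<in> cols - T \<Longrightarrow> a' i = a i"
    and a'1: "\<And>i. i \<in> T \<Longrightarrow> 1 \<le> a' i * val A i"
    and P': "bij_betw P' cols cols" and B': "disc_ladder p B'"
    and P1: "bij_betw P1 cols cols" and B1: "disc_ladder p B1"
    and c: "\<And>i. i \<in> T \<Longrightarrow> c i \<le> val A i * clicks B1 (P1 i) - price B1 (P1 i)"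
    and K: "K \<le> score a' P' B'"
  shows "\<exists>Q B. bij_betw Q cols cols \<and> disc_ladder p B \<and> K + (\<Sum>i\<in>T. (a i - a' i) * c i) \<le> score a Q B"
proof -
  have TC: "T \<subseteq> cols" using T by blast
  have finT: "finite T" using TC by (rule finite_subset) simp
  define w where "w i = a i * val A i" for i
  \<comment> \<open>Sorting by weighted value reuses \<open>place\<close>, with these values in the
    role of bids.\<close>
  define Q where "Q = place A (\<lambda>i. (w i, 0))"
  have Q: "bij_betw Q cols cols" unfolding Q_def by (rule place_bij)
  have sorted: "w j \<le> w i" if "i \<in> cols" "j \<in> cols" "Q i \<le> Q j" for i j
  proof (rule ccontr)
    assume "\<not> w j \<le> w i"
    then have "ranked_above (\<lambda>i. (w i, 0)) (\<lambda>_. 0) (Colluder j) (Colluder i)" by simp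
    from place_less[OF that(2) this] that(3) show False by (simp add: Q_def)
  qed
  have wT: "1 < w i" if "i \<in> T" for i using that by (simp add: T w_def)
  have wO: "w i \<le> 1" if "i \<in> cols - T" for i using that by (auto simp: T w_def not_less)
  \<comment> \<open>The same order sorts the smaller weights: within \<open>T\<close> all shrink by
    the factor \<open>s\<close>, and their values stay at or above 1 while the others are at most
    1.\<close>
  have sorted': "a' j * val A j \<le> a' i * val A i" if ij: "i \<in> cols" "j \<in> cols" "Q i \<le> Q j" for i j
  proof (cases "i \<in> T")
    case True
    show ?thesis
    proof (cases "j \<in> T")
      case jT: True
      have "s * (a' j * val A j) \<le> s * (a' i * val A i)"
        using sorted[OF ij] a'(1)[OF True] a'(1)[OF jT] by (simp add: w_def)
      then show ?thesis using s by simp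
    next
      case False
      then show ?thesis using a'1[OF True] wO[of j] a'(2)[of j] ij by (simp add: w_def)
    qed
  next
    case False
    then have "j \<notin> T" using sorted[OF ij] wT[of j] wO[of i] ij by auto
    then show ?thesis using sorted[OF ij] a'(2)[of i] a'(2)[of j] False ij by (simp add: w_def)
  qed
  have lB': "ladder A B'" and lB1: "ladder A B1"
    using B' B1 by (simp_all add: disc_ladder_def)
  have K': "K \<le> score a' Q B'"
    using score_sort[OF P' Q lB' sorted'] K by linarith
  have QC: "Q i \<in> cols" if "i \<in> cols" for i
    using bij_betw_apply[OF Q that] .
  have QT: "bij_betw Q T {1..card T}"
  proof (rule bij_betw_initial_segment[OF Q TC])
    fix i j assume ij: "i \<in> T" "j \<in> cols - T"
    show "Q i < Q j"
    proof (rule ccontr)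
      assume "\<not> Q i < Q j"
      then have "w i \<le> w j" using sorted[of j i] ij TC by auto
      then show False using wT[OF ij(1)] wO[OF ij(2)] by simp
    qed
  qed
  define R where "R = (\<Sum>i\<in>T. a' i * val A i * clicks B' (Q i))"
  define cT where "cT = (\<Sum>i\<in>T. a' i * c i)"
  have scale: "(\<Sum>i\<in>T. (a i - a' i) * c i) = (s - 1) * cT"
    unfolding cT_def sum_distrib_left by (rule sum.cong) (simp_all add: a'(1) algebra_simps)
  have score_a: "score a Q B' = score a' Q B' + (s - 1) * R"
  proof -
    have "score a Q B' - score a' Q B' = (\<Sum>i\<in>cols. (a i - a' i) * val A i * clicks B' (Q i))"
      unfolding score_def sum_subtractf[symmetric] by (rule sum.cong) (simp_all add: algebra_simps)
    also have "\<dots> = (\<Sum>i\<in>T. (a i - a' i) * val A i * clicks B' (Q i))"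
      using TC a'(2) by (intro sum.mono_neutral_right) auto
    also have "\<dots> = (s - 1) * R"
      unfolding R_def sum_distrib_left by (rule sum.cong) (simp_all add: a'(1) algebra_simps)
    finally show ?thesis by simp
  qed
  show ?thesis
  \<comment> \<open>Passing from \<open>a'\<close> to \<open>a\<close> raises the target by
    \<open>(s - 1) * cT\<close> and the score of \<open>B'\<close> by
    \<open>(s - 1) * R\<close>.\<close>
  proof (cases "cT \<le> R")
    case True
    then have "(s - 1) * cT \<le> (s - 1) * R" using s by (intro mult_left_mono) auto
    then show ?thesis using Q B' K' score_a scale by (intro exI[of _ Q] exI[of _ B']) auto
  next
    case False
    obtain P2 B2 where P2: "bij_betw P2 cols cols" and lB2: "ladder A B2"
      and B2: "\<And>k. k \<in> cols \<Longrightarrow> B2 k \<in> insert 0 (B1 ` cols)"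
      and P2T: "bij_betw P2 T {1..card T}" and B20: "\<And>k. \<lbrakk>k \<in> cols; card T < k\<rbrakk> \<Longrightarrow> B2 k = 0"
      and gain: "\<And>i a. \<lbrakk>i \<in> T; 1 \<le> a\<rbrakk> \<Longrightarrow>
        a * clicks B1 (P1 i) - price B1 (P1 i) \<le> a * clicks B2 (P2 i) - price B2 (P2 i)"
      using concentrate[OF P1 lB1 TC] by blast
    have "B2 k \<in> left_ends A p" if "k \<in> cols" for k
      using B2[OF that] B1 zero_in_left_ends[of A p] by (auto simp: disc_ladder_def)
    then have dB2: "disc_ladder p B2" using lB2 by (simp add: disc_ladder_def)
    define J where "J = (\<lambda>k. max (B' k) (B2 k))"
    define M where "M = (\<lambda>k. min (B' k) (B2 k))"
    define h where "h B i = w i * clicks B (Q i) - price B (Q i)" for B i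
    have lM: "ladder A M" unfolding M_def by (rule ladder_max(2)[OF lB' lB2])
    have J: "disc_ladder p J" unfolding J_def by (rule disc_ladder_max[OF B' dB2])
    have score_h: "score a Q B = (\<Sum>i\<in>cols. h B i)" for B
      by (simp add: score_def h_def w_def)
    have exchange: "h B' i + h B2 i \<le> h J i + h M i" if "i \<in> cols" for i
    proof -
      have "clicks J (Q i) + clicks M (Q i) = clicks B' (Q i) + clicks B2 (Q i)"
        unfolding J_def M_def by (rule clicks_exchange)
      then have "w i * clicks J (Q i) + w i * clicks M (Q i) = w i * clicks B' (Q i) + w i * clicks B2 (Q i)"
        by (metis distrib_left)
      moreover have "price J (Q i) + price M (Q i) \<le> price B' (Q i) + price B2 (Q i)"
        unfolding J_def M_def by (rule price_exchange[OF lB' lB2 QC[OF that]])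
      ultimately show ?thesis unfolding h_def by linarith
    qed
    \<comment> \<open>Beyond the first \<open>card T\<close> positions \<open>B2\<close> is 0 and
      agrees with the minimum \<open>M\<close>, so these terms cancel in the exchange
      inequality.\<close>
    have hO: "h B2 i = h M i" if "i \<in> cols - T" for i
    proof -
      have iC: "i \<in> cols" using that by simp
      have "\<not> Q i \<le> card T"
      proof
        assume "Q i \<le> card T"
        then have "Q i \<in> Q ` T" using bij_betw_imp_surj_on[OF QT] QC[OF iC] by simp
        then obtain j where "j \<in> T" "Q i = Q j" by blast
        then show False
          using that inj_on_eq_iff[OF bij_betw_imp_inj_on[OF Q] iC, of j] TC by blast
      qed
      then have z: "B2 (Q i) = 0" using B20 QC[OF iC] by simp
      then have zM: "M (Q i) = 0"
        using ladder_bounds[OF lB' QC[OF iC]] by (simp add: M_def)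
      have "clicks M (Q i) = clicks B2 (Q i)"
        by (simp add: clicks_def seq_rank_def z zM)
      then show ?thesis
        using price_bottom[of B2, OF lB2 QC[OF iC] z] price_bottom[of M, OF lM QC[OF iC] zM]
        by (simp add: h_def)
    qed
    \<comment> \<open>For the minimum it is enough to drop the payments and to bound its clicks by
      those of \<open>B'\<close>.\<close>
    have hM: "(\<Sum>i\<in>T. h M i) \<le> s * R"
    proof -
      have "h M i \<le> s * (a' i * val A i * clicks B' (Q i))" if "i \<in> T" for i
      proof -
        have k: "1 \<le> Q i" using QC TC that by auto
        have "w i * clicks M (Q i) \<le> w i * clicks B' (Q i)"
          using wT[OF that] k by (intro mult_left_mono clicks_mono) (auto simp: M_def)
        moreover have "0 \<le> price M (Q i)" by (rule price_nonneg[OF k])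
        moreover have "w i * clicks B' (Q i) = s * (a' i * val A i * clicks B' (Q i))"
          by (simp add: w_def a'(1)[OF that] mult.assoc)
        ultimately show ?thesis unfolding h_def by linarith
      qed
      then show ?thesis unfolding R_def sum_distrib_left by (rule sum_mono)
    qed
    \<comment> \<open>As \<open>a i \<ge> 1\<close>, weighting the payments as well only lowers the
      value, so \<open>T\<close> is worth at least \<open>s * cT\<close> on \<open>B1\<close>.
      Concentrating \<open>T\<close> and re-sorting it by \<open>Q\<close> can only help.\<close>
    have hB2: "s * cT \<le> (\<Sum>i\<in>T. h B2 i)"
    proof -
      have "s * (a' i * c i) \<le> w i * clicks B2 (P2 i) - price B2 (P2 i)" if "i \<in> T" for i
      proof -
        have iC: "i \<in> cols" using that TC by blast
        have pr: "0 \<le> price B1 (P1 i)"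
          using bij_betw_apply[OF P1 iC] by (intro price_nonneg) auto
        have "a i * c i \<le> a i * (val A i * clicks B1 (P1 i) - price B1 (P1 i))"
          using a1[OF iC] by (intro mult_left_mono c that) auto
        also have "\<dots> = w i * clicks B1 (P1 i) - a i * price B1 (P1 i)"
          by (simp add: w_def algebra_simps)
        also have "\<dots> \<le> w i * clicks B1 (P1 i) - price B1 (P1 i)"
          using mult_right_mono[OF a1[OF iC] pr] by simp
        also have "\<dots> \<le> w i * clicks B2 (P2 i) - price B2 (P2 i)"
          using wT[OF that] by (intro gain that) simp
        finally show ?thesis by (simp add: a'(1)[OF that] mult.assoc)
      qed
      then have "s * cT \<le> (\<Sum>i\<in>T. w i * clicks B2 (P2 i) - price B2 (P2 i))"
        unfolding cT_def sum_distrib_left by (rule sum_mono)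
      moreover have "(\<Sum>i\<in>T. w i * clicks B2 (P2 i)) \<le> (\<Sum>i\<in>T. w i * clicks B2 (Q i))"
      proof (rule rearrangement[OF P2T QT])
        show "w j \<le> w i" if "i \<in> T" "j \<in> T" "Q i \<le> Q j" for i j
          using sorted[of i j] that TC by blast
        have "card T \<le> n_col A" using card_mono[OF _ TC] by simp
        then show "clicks B2 l \<le> clicks B2 k" if "1 \<le> k" "k \<le> l" "l \<le> card T" for k l
          using clicks_ladder_antimono[OF lB2 that(1,2)] that(3) by linarith
      qed
      ultimately show ?thesis
        unfolding h_def sum_subtractf using sum_price_bij[OF P2T QT, of B2] by linarith
    qed
    have split: "(\<Sum>i\<in>cols. h B i) = (\<Sum>i\<in>T. h B i) + (\<Sum>i\<in>cols - T. h B i)" for B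
      using sum.subset_diff[OF TC, of "h B"] by simp
    have "(\<Sum>i\<in>cols. h B' i) + (\<Sum>i\<in>cols. h B2 i) \<le> (\<Sum>i\<in>cols. h J i) + (\<Sum>i\<in>cols. h M i)"
      unfolding sum.distrib[symmetric] by (rule sum_mono) (rule exchange)
    moreover have "(\<Sum>i\<in>cols - T. h B2 i) = (\<Sum>i\<in>cols - T. h M i)"
      by (rule sum.cong[OF refl]) (rule hO)
    ultimately have "score a Q B' + (\<Sum>i\<in>T. h B2 i) - (\<Sum>i\<in>T. h M i) \<le> score a Q J"
      using split[of B2] split[of M] unfolding score_h by linarith
    \<comment> \<open>The gain is \<open>s * cT - R\<close>, which exceeds
      \<open>(s - 1) * cT\<close> because \<open>R < cT\<close>.\<close>
    then have "score a' Q B' + (s - 1) * R + s * cT - s * R \<le> score a Q J"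
      using hM hB2 score_a by linarith
    then have "K + (s - 1) * cT \<le> score a Q J"
      using K' False by (simp add: algebra_simps)
    then show ?thesis using Q J scale by (intro exI[of _ Q] exI[of _ J]) simp
  qed
qed

text \<open>Induction on the number of weighted values above 1. Dividing the weights of these
  colluders by the smallest such value brings one value to exactly 1 and keeps the rest at least 1.
  As valuations are at most 1, the new weights are still at least 1; \<open>score_raise\<close>
  undoes the division.\<close>

lemma score_dual:
  fixes c :: "nat \<Rightarrow> real" and p V :: real
  assumes base: "\<And>a. (\<And>i. i \<in> cols \<Longrightarrow> 1 \<le> a i \<and> a i * val A i \<le> 1) \<Longrightarrow>
      \<exists>P B. bij_betw P cols cols \<and> disc_ladder p B \<and> V + (\<Sum>i\<in>cols. a i * c i) \<le> score a P B"
    and P1: "bij_betw P1 cols cols" and B1: "disc_ladder p B1"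
    and c: "\<And>i. i \<in> cols \<Longrightarrow> c i \<le> val A i * clicks B1 (P1 i) - price B1 (P1 i)"
    and a1: "\<And>i. i \<in> cols \<Longrightarrow> 1 \<le> a i"
  shows "\<exists>P B. bij_betw P cols cols \<and> disc_ladder p B \<and> V + (\<Sum>i\<in>cols. a i * c i) \<le> score a P B"
  using a1
proof (induction "card {i \<in> cols. 1 < a i * val A i}" arbitrary: a rule: less_induct)
  case less
  define T where "T = {i \<in> cols. 1 < a i * val A i}"
  show ?case
  proof (cases "T = {}")
    case True
    then show ?thesis using less.prems by (intro base) (auto simp: T_def not_less)
  next
    case False
    have finT: "finite T" by (simp add: T_def)
    define s where "s = Min ((\<lambda>i. a i * val A i) ` T)"
    have "s \<in> (\<lambda>i. a i * val A i) ` T"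
      unfolding s_def using finT False by (intro Min_in) auto
    then obtain i0 where i0: "i0 \<in> T" "s = a i0 * val A i0" by blast
    have s1: "1 < s" using i0 by (simp add: T_def)
    have sle: "s \<le> a i * val A i" if "i \<in> T" for i
      unfolding s_def using finT that by (intro Min_le) auto
    define a' where "a' i = (if i \<in> T then a i / s else a i)" for i
    have a'T: "1 \<le> a' i * val A i" if "i \<in> T" for i
      using sle[OF that] s1 that by (simp add: a'_def)
    have a'1: "1 \<le> a' i" if i: "i \<in> cols" for i
    proof (cases "i \<in> T")
      case True
      have "0 < a i" using less.prems[OF i] by simp
      then have "0 \<le> a' i" using True s1 by (simp add: a'_def)
      then have "a' i * val A i \<le> a' i"
        using val_bounds[OF i] mult_left_le by blast
      then show ?thesis using a'T[OF True] by linarith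
    next
      case False
      then show ?thesis using less.prems[OF i] by (simp add: a'_def)
    qed
    have "{i \<in> cols. 1 < a' i * val A i} \<subset> T"
    proof
      show "{i \<in> cols. 1 < a' i * val A i} \<subseteq> T"
        by (auto simp: a'_def T_def split: if_splits)
      have "a' i0 * val A i0 = a i0 * val A i0 / s" using i0(1) by (simp add: a'_def)
      also have "\<dots> = s / s" by (simp only: i0(2))
      also have "\<dots> = 1" using s1 by simp
      finally show "{i \<in> cols. 1 < a' i * val A i} \<noteq> T" using i0(1) by auto
    qed
    then have "card {i \<in> cols. 1 < a' i * val A i} < card {i \<in> cols. 1 < a i * val A i}"
      unfolding T_def[symmetric] by (rule psubset_card_mono[OF finT])
    from less.hyps[OF this] a'1 obtain P' B' where
      P'B': "bij_betw P' cols cols" "disc_ladder p B'" "V + (\<Sum>i\<in>cols. a' i * c i) \<le> score a' P' B'"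
      by blast
    have "\<exists>Q B. bij_betw Q cols cols \<and> disc_ladder p B \<and>
        V + (\<Sum>i\<in>cols. a' i * c i) + (\<Sum>i\<in>T. (a i - a' i) * c i) \<le> score a Q B"
    proof (rule score_raise[OF _ _ _ _ _ _ P'B'(1,2) P1 B1 _ P'B'(3)])
      show "T = {i \<in> cols. 1 < a i * val A i}" by (rule T_def)
      show "1 \<le> s" using s1 by simp
      show "a i = s * a' i" if "i \<in> T" for i using that s1 by (simp add: a'_def)
      show "a' i = a i" if "i \<in> cols - T" for i using that by (simp add: a'_def)
      show "c i \<le> val A i * clicks B1 (P1 i) - price B1 (P1 i)" if "i \<in> T" for i
        using c that by (simp add: T_def)
    qed (use less.prems a'T in auto)
    moreover have "(\<Sum>i\<in>T. (a i - a' i) * c i) = (\<Sum>i\<in>cols. (a i - a' i) * c i)"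
      by (rule sum.mono_neutral_left) (auto simp: T_def a'_def)
    then have "(\<Sum>i\<in>cols. a' i * c i) + (\<Sum>i\<in>T. (a i - a' i) * c i) = (\<Sum>i\<in>cols. a i * c i)"
      by (simp add: sum.distrib[symmetric] algebra_simps)
    ultimately show ?thesis by (simp add: add.assoc)
  qed
qed

end

section \<open>Convex combinations and multipliers\<close>

text \<open>The linear term is the derivative of the squared violation; with the quadratic remainder
  it replaces differentiation in the optimality condition.\<close>

lemma min0_square_le: "(min 0 (v + h))\<^sup>2 \<le> (min 0 v)\<^sup>2 + 2 * min 0 v * h + (h::real)\<^sup>2"
proof (cases "v < 0")
  case True
  have "(min 0 (v + h))\<^sup>2 \<le> (v + h)\<^sup>2" by (simp add: min_def)
  then show ?thesis using True by (simp add: power2_sum min_def)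
next
  case False
  then have "\<bar>min 0 (v + h)\<bar> \<le> \<bar>h\<bar>" by linarith
  then have "(min 0 (v + h))\<^sup>2 \<le> h\<^sup>2" by (simp only: abs_le_square_iff)
  then show ?thesis using False by (simp add: min_def)
qed

lemma nonneg_of_small_perturbation:
  fixes X D :: real
  assumes "0 \<le> D" "\<And>\<epsilon>. \<lbrakk>0 < \<epsilon>; \<epsilon> \<le> 1\<rbrakk> \<Longrightarrow> 0 \<le> 2 * X + \<epsilon> * D"
  shows "0 \<le> X"
proof (rule ccontr)
  assume "\<not> 0 \<le> X"
  then have X: "X < 0" by simp
  \<comment> \<open>Chosen with \<open>\<epsilon> * (D - X) = - X\<close>, so that
    \<open>\<epsilon> * D\<close> stays below \<open>- X\<close>.\<close>
  define \<epsilon> where "\<epsilon> = - X / (D - X)"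
  have pos: "0 < D - X" using X assms(1) by simp
  have "0 < \<epsilon>" unfolding \<epsilon>_def using X pos by (intro divide_pos_pos) auto
  moreover have "\<epsilon> \<le> 1" unfolding \<epsilon>_def using assms(1) pos by (subst divide_le_eq_1_pos) auto
  ultimately have le: "0 \<le> 2 * X + \<epsilon> * D" by (rule assms(2))
  have "\<epsilon> * (D - X) = - X" using pos by (simp add: \<epsilon>_def)
  moreover have "\<epsilon> * X < 0" using \<open>0 < \<epsilon>\<close> X by (rule mult_pos_neg)
  ultimately have "\<epsilon> * D < - X" by (simp add: right_diff_distrib)
  then show False using le X by linarith
qed

text \<open>A convex combination minimising the sum of the squared violations: its violations are
  multipliers that no generator satisfies unless they all vanish.\<close>

lemma convex_alternative:
  fixes F :: "'a \<Rightarrow> 'b \<Rightarrow> real"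
  assumes S: "finite S" "S \<noteq> {}" and I: "finite I"
    and alt: "\<And>\<mu>. (\<And>i. i \<in> I \<Longrightarrow> 0 \<le> \<mu> i) \<Longrightarrow> \<exists>s\<in>S. 0 \<le> (\<Sum>i\<in>I. \<mu> i * F s i)"
  shows "\<exists>g. (\<forall>s. 0 \<le> g s) \<and> (\<forall>s. s \<notin> S \<longrightarrow> g s = 0) \<and> (\<Sum>s\<in>S. g s) = 1 \<and>
           (\<forall>i\<in>I. 0 \<le> (\<Sum>s\<in>S. g s * F s i))"
proof -
  \<comment> \<open>Weights are pinned to 0 outside \<open>S\<close>, so Tychonoff gives compactness
    even when the index type is infinite.\<close>
  define K where "K = PiE UNIV (\<lambda>s. if s \<in> S then {0..1} else {0::real}) \<inter> {g. (\<Sum>s\<in>S. g s) = 1}"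
  define v where "v g i = (\<Sum>s\<in>S. g s * F s i)" for g i
  define f where "f g = (\<Sum>i\<in>I. (min 0 (v g i))\<^sup>2)" for g
  have coord: "continuous_on X (\<lambda>g :: 'a \<Rightarrow> real. g s)" for X s
    by (rule continuous_on_subset[OF continuous_on_product_coordinates]) simp
  have "compactin (product_topology (\<lambda>_. euclidean) UNIV) (PiE UNIV (\<lambda>s. if s \<in> S then {0..1} else {0::real}))"
    unfolding compactin_PiE by (auto simp: compactin_euclidean_iff)
  then have "compact (PiE UNIV (\<lambda>s. if s \<in> S then {0..1} else {0::real}))"
    by (simp only: euclidean_product_topology compactin_euclidean_iff)
  moreover have "closed {g. (\<Sum>s\<in>S. g s) = (1::real)}"
    by (intro closed_Collect_eq continuous_on_sum coord continuous_on_const)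
  ultimately have "compact K"
    unfolding K_def by (rule compact_Int_closed)
  moreover have "K \<noteq> {}"
  proof -
    obtain s0 where "s0 \<in> S" using S by blast
    then have "(\<lambda>s. if s = s0 then 1 else 0) \<in> K"
      using S(1) by (auto simp: K_def)
    then show ?thesis by blast
  qed
  moreover have "continuous_on K f"
    unfolding f_def v_def by (intro continuous_intros coord)
  ultimately obtain g where g: "g \<in> K" and gmin: "\<And>h. h \<in> K \<Longrightarrow> f g \<le> f h"
    using continuous_attains_inf by metis
  have g0: "0 \<le> g s \<and> g s \<le> 1" "s \<notin> S \<Longrightarrow> g s = 0" for s
    using g by (auto simp: K_def PiE_iff split: if_splits)
  have g1: "(\<Sum>s\<in>S. g s) = 1" using g by (simp add: K_def)
  define \<mu> where "\<mu> i = - min 0 (v g i)" for i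
  obtain s0 where s0: "s0 \<in> S" "0 \<le> (\<Sum>i\<in>I. \<mu> i * F s0 i)"
    using alt[of \<mu>] by (auto simp: \<mu>_def)
  define d where "d i = F s0 i - v g i" for i
  \<comment> \<open>First-order condition at the minimiser \<open>g\<close> in the direction of the
    vertex \<open>s0\<close>.\<close>
  have "0 \<le> (\<Sum>i\<in>I. min 0 (v g i) * d i)"
  proof (rule nonneg_of_small_perturbation)
    show "0 \<le> (\<Sum>i\<in>I. (d i)\<^sup>2)" by (simp add: sum_nonneg)
    fix \<epsilon> :: real assume \<epsilon>: "0 < \<epsilon>" "\<epsilon> \<le> 1"
    define h where "h s = (1 - \<epsilon>) * g s + \<epsilon> * (if s = s0 then 1 else 0)" for s
    have "h s \<in> (if s \<in> S then {0..1} else {0})" for s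
    proof (cases "s \<in> S")
      case True
      have "0 \<le> (1 - \<epsilon>) * g s" "(1 - \<epsilon>) * g s \<le> 1 - \<epsilon>"
        using \<epsilon> g0(1)[of s] by (auto intro: mult_left_le)
      then show ?thesis using True \<epsilon> by (auto simp: h_def)
    next
      case False
      then show ?thesis using g0(2) s0(1) by (auto simp: h_def)
    qed
    moreover have "(\<Sum>s\<in>S. h s) = 1"
      using g1 s0(1) S(1) by (simp add: h_def sum.distrib sum_distrib_left[symmetric])
    ultimately have "h \<in> K" by (simp add: K_def PiE_iff)
    have vh: "v h i = v g i + \<epsilon> * d i" for i
    proof -
      have "v h i = (1 - \<epsilon>) * v g i + \<epsilon> * (\<Sum>s\<in>S. (if s = s0 then 1 else 0) * F s i)"
        unfolding v_def h_def sum_distrib_left sum.distrib[symmetric]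
        by (rule sum.cong) (simp_all add: algebra_simps)
      also have "(\<Sum>s\<in>S. (if s = s0 then 1 else 0) * F s i) = F s0 i"
        using s0(1) S(1) by (simp add: if_distrib[of "\<lambda>x. x * _"] cong: if_cong)
      finally show ?thesis by (simp add: d_def algebra_simps)
    qed
    have "f g \<le> f h" by (rule gmin[OF \<open>h \<in> K\<close>])
    also have "\<dots> \<le> (\<Sum>i\<in>I. (min 0 (v g i))\<^sup>2 + 2 * min 0 (v g i) * (\<epsilon> * d i) + (\<epsilon> * d i)\<^sup>2)"
      unfolding f_def vh by (rule sum_mono) (rule min0_square_le)
    also have "\<dots> = f g + \<epsilon> * (2 * (\<Sum>i\<in>I. min 0 (v g i) * d i) + \<epsilon> * (\<Sum>i\<in>I. (d i)\<^sup>2))"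
      unfolding f_def sum_distrib_left sum.distrib[symmetric]
      by (rule sum.cong) (simp_all add: algebra_simps power2_eq_square)
    finally show "0 \<le> 2 * (\<Sum>i\<in>I. min 0 (v g i) * d i) + \<epsilon> * (\<Sum>i\<in>I. (d i)\<^sup>2)"
      using \<epsilon>(1) by (simp add: zero_le_mult_iff)
  qed
  \<comment> \<open>Since \<open>min 0 (v g i) * v g i\<close> is the square of
    \<open>\<mu> i\<close>, the choice of \<open>s0\<close> forces the sum of these squares to be
    nonpositive.\<close>
  also have "(\<Sum>i\<in>I. min 0 (v g i) * d i) = - (\<Sum>i\<in>I. \<mu> i * F s0 i) - (\<Sum>i\<in>I. (\<mu> i)\<^sup>2)"
    unfolding sum_negf[symmetric] sum_subtractf[symmetric]
    by (rule sum.cong) (auto simp: \<mu>_def d_def min_def algebra_simps power2_eq_square)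
  finally have "(\<Sum>i\<in>I. (\<mu> i)\<^sup>2) \<le> 0" using s0(2) by linarith
  then have "(\<Sum>i\<in>I. (\<mu> i)\<^sup>2) = 0" by (simp add: sum_nonneg antisym)
  then have mu0: "\<mu> i = 0" if "i \<in> I" for i
    using I that by (simp add: sum_nonneg_eq_0_iff)
  have "0 \<le> (\<Sum>s\<in>S. g s * F s i)" if "i \<in> I" for i
    using mu0[OF that] unfolding \<mu>_def v_def by linarith
  then show ?thesis using g0 g1 by blast
qed

text \<open>If some multipliers failed strictly on all of the finite set \<open>S\<close>, they
  would still fail after a small increase of \<open>\<mu> j\<close>. Positivity of one multiplier
  allows normalising by it.\<close>

lemma convex_alternative_pos:
  fixes F :: "'a \<Rightarrow> 'b \<Rightarrow> real"
  assumes S: "finite S" "S \<noteq> {}" and I: "finite I" and j: "j \<in> I"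
    and alt: "\<And>\<mu>. \<lbrakk>\<And>i. i \<in> I \<Longrightarrow> 0 \<le> \<mu> i; 0 < \<mu> j\<rbrakk> \<Longrightarrow> \<exists>s\<in>S. 0 \<le> (\<Sum>i\<in>I. \<mu> i * F s i)"
  shows "\<exists>g. (\<forall>s. 0 \<le> g s) \<and> (\<forall>s. s \<notin> S \<longrightarrow> g s = 0) \<and> (\<Sum>s\<in>S. g s) = 1 \<and>
           (\<forall>i\<in>I. 0 \<le> (\<Sum>s\<in>S. g s * F s i))"
proof (rule convex_alternative[OF S I])
  fix \<mu> :: "'b \<Rightarrow> real" assume \<mu>: "\<And>i. i \<in> I \<Longrightarrow> 0 \<le> \<mu> i"
  show "\<exists>s\<in>S. 0 \<le> (\<Sum>i\<in>I. \<mu> i * F s i)"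
  proof (rule ccontr)
    assume "\<not> ?thesis"
    then have neg: "(\<Sum>i\<in>I. \<mu> i * F s i) < 0" if "s \<in> S" for s
      using that by (auto simp: not_le)
    have "\<forall>\<^sub>F \<epsilon> in at_right 0. (\<Sum>i\<in>I. \<mu> i * F s i) + \<epsilon> * F s j < 0" if "s \<in> S" for s
    proof (rule order_tendstoD(2)[OF _ neg[OF that]])
      have "((\<lambda>\<epsilon>. (\<Sum>i\<in>I. \<mu> i * F s i) + \<epsilon> * F s j) \<longlongrightarrow> (\<Sum>i\<in>I. \<mu> i * F s i) + 0 * F s j) (at_right 0)"
        by (intro tendsto_intros)
      then show "((\<lambda>\<epsilon>. (\<Sum>i\<in>I. \<mu> i * F s i) + \<epsilon> * F s j) \<longlongrightarrow> (\<Sum>i\<in>I. \<mu> i * F s i)) (at_right 0)"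
        by simp
    qed
    then have "\<forall>\<^sub>F \<epsilon> in at_right 0. \<forall>s\<in>S. (\<Sum>i\<in>I. \<mu> i * F s i) + \<epsilon> * F s j < 0"
      using S(1) by (simp add: eventually_ball_finite)
    moreover have "\<forall>\<^sub>F \<epsilon> :: real in at_right 0. 0 < \<epsilon>"
      by (rule eventually_at_right_less)
    ultimately have ev: "\<forall>\<^sub>F \<epsilon> :: real in at_right 0. 0 < \<epsilon> \<and> (\<forall>s\<in>S. (\<Sum>i\<in>I. \<mu> i * F s i) + \<epsilon> * F s j < 0)"
      by eventually_elim simp
    have "\<exists>\<epsilon> > 0. \<forall>s\<in>S. (\<Sum>i\<in>I. \<mu> i * F s i) + \<epsilon> * F s j < 0"
      using eventually_happens[OF ev] trivial_limit_at_right_real[of "0::real"] by blast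
    then obtain \<epsilon> where \<epsilon>: "0 < \<epsilon>" "\<And>s. s \<in> S \<Longrightarrow> (\<Sum>i\<in>I. \<mu> i * F s i) + \<epsilon> * F s j < 0"
      by blast
    have "\<exists>s\<in>S. 0 \<le> (\<Sum>i\<in>I. (\<mu> i + (if i = j then \<epsilon> else 0)) * F s i)"
      using \<mu> \<epsilon>(1) j by (intro alt) (auto simp: add_nonneg_pos)
    moreover have "(\<Sum>i\<in>I. (\<mu> i + (if i = j then \<epsilon> else 0)) * F s i) = (\<Sum>i\<in>I. \<mu> i * F s i) + \<epsilon> * F s j" for s
      using I j by (simp add: distrib_right sum.distrib if_distrib[of "\<lambda>x. x * _"] cong: if_cong)
    ultimately show False using \<epsilon>(2) by force
  qed
qed

lemma pmf_of_weights:
  fixes g :: "'a \<Rightarrow> real"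
  assumes "finite S" "\<And>s. 0 \<le> g s" "\<And>s. s \<notin> S \<Longrightarrow> g s = 0" "(\<Sum>s\<in>S. g s) = 1"
  obtains \<gamma> where "set_pmf \<gamma> \<subseteq> S" "\<And>s. pmf \<gamma> s = g s"
proof -
  have "(\<integral>\<^sup>+s. ennreal (g s) \<partial>count_space UNIV) = (\<Sum>s\<in>S. ennreal (g s))"
    using assms by (intro nn_integral_count_space') auto
  also have "\<dots> = 1" using assms by (simp add: sum_ennreal)
  finally have "pmf (embed_pmf g) s = g s" for s
    using assms by (intro pmf_embed_pmf) auto
  moreover from this have "set_pmf (embed_pmf g) \<subseteq> S"
    using assms(3) by (metis set_pmf_iff subsetI)
  ultimately show ?thesis using that by blast
qed

section \<open>The linear program\<close>

context ad_setting
begin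

lemma plain_placed:
  assumes "b \<in> cols \<rightarrow>\<^sub>E {0..1}"
  obtains P B where "placed A (plain b) P B" "bij_betw P cols cols" "ladder A B"
proof -
  have "0 \<le> fst (plain b i) \<and> fst (plain b i) \<le> 1" if "i \<in> cols" for i
    using PiE_mem[OF assms that] by (simp add: plain_def)
  note pl = placed_exists[of A "plain b", OF this]
  show ?thesis
    by (rule that[OF pl]) (use pl in \<open>simp_all only: placed_def\<close>)
qed

lemma disc_ladder_round_down:
  assumes "ladder A B"
  shows "disc_ladder p (\<lambda>k. round_down A p (B k))"
  using ladder_round_down[OF assms] round_down(1)[of _ A p] ladder_bounds[OF assms]
  by (simp add: disc_ladder_def)

lemma seq_strategy_disc:
  assumes P: "bij_betw P cols cols" and B: "disc_ladder p B"
  shows "seq_strategy A P B \<in> disc_strategies A p"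
  unfolding disc_strategies_def
proof (rule PiE_I)
  fix i assume i: "i \<in> cols"
  have Pi: "P i \<in> cols" by (rule bij_betw_apply[OF P i])
  then have "B (P i) \<in> left_ends A p" using B by (simp add: disc_ladder_def)
  then obtain \<beta> where "(B (P i), \<beta>) \<in> rec_intervals A p 0 1"
    by (auto simp: left_ends_def)
  moreover have "n_col A + 1 - P i \<in> cols" using Pi by auto
  ultimately show "seq_strategy A P B i \<in> disc_bids A p"
    using i unfolding disc_bids_def seq_strategy_def by auto
next
  fix i assume "i \<notin> cols"
  then show "seq_strategy A P B i = undefined"
    unfolding seq_strategy_def by (simp only: restrict_apply if_False)
qed

lemma exp_payment_nonneg:
  assumes "b \<in> cols \<rightarrow>\<^sub>E {0..1}" "i \<in> cols"
  shows "0 \<le> exp_payment mech A i (plain b)"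
proof -
  obtain P B where pl: "placed A (plain b) P B" and P: "bij_betw P cols cols"
    using plain_placed[OF assms(1)] by blast
  show ?thesis
    unfolding placed_expected(1)[OF pl assms(2)]
    using bij_betw_apply[OF P assms(2)] by (intro price_nonneg) auto
qed

text \<open>Assumption \<open>U\<close> is what a mixture of ordinary strategies with value
  \<open>U\<close> and expected revenues at least \<open>t\<close> yields against each weight
  vector. In this dual form, discretization concerns single strategies;
  \<open>convex_alternative_pos\<close> then returns a mixture.\<close>

lemma disc_mixture:
  fixes p U :: real and t :: "nat \<Rightarrow> real"
  assumes p: "0 \<le> p"
    and bstar: "bstar \<in> cols \<rightarrow>\<^sub>E {0..1}"
      "\<And>i. i \<in> cols \<Longrightarrow> t i \<le> exp_revenue A i (plain bstar) - exp_payment mech A i (plain bstar)"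
    and U: "\<And>a. (\<And>i. i \<in> cols \<Longrightarrow> 1 \<le> a i) \<Longrightarrow> \<exists>b \<in> cols \<rightarrow>\<^sub>E {0..1}. U + (\<Sum>i\<in>cols. (a i - 1) * t i)
        \<le> (\<Sum>i\<in>cols. a i * exp_revenue A i (plain b) - exp_payment mech A i (plain b))"
  shows "\<exists>\<gamma>. set_pmf \<gamma> \<subseteq> disc_strategies A p \<and>
    (\<forall>i\<in>cols. t i - p \<le> (\<Sum>b\<in>disc_strategies A p. pmf \<gamma> b * exp_revenue A i b)) \<and>
    U - p * real (n_col A) \<le> lp_objective mech A p \<gamma>"
proof -
  define S where "S = disc_strategies A p"
  define util where "util b = (\<Sum>i\<in>cols. exp_revenue A i b - exp_payment mech A i b)" for b
  \<comment> \<open>Index 0 is free, as colluders start at 1, and carries the objective; the other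
    indices carry the revenue constraints.\<close>
  define F where "F b i = (if i = 0 then util b - (U - p * real (n_col A))
    else exp_revenue A i b - (t i - p))" for b and i :: nat
  obtain P0 B0 where pl0: "placed A (plain bstar) P0 B0" and P0: "bij_betw P0 cols cols" and B0: "ladder A B0"
    using plain_placed[OF bstar(1)] by blast
  define B1 where "B1 k = round_down A p (B0 k)" for k
  have B1: "disc_ladder p B1" unfolding B1_def by (rule disc_ladder_round_down[OF B0])
  have c1: "t i - p \<le> val A i * clicks B1 (P0 i) - price B1 (P0 i)" if i: "i \<in> cols" for i
    using round_down_loss[OF B0 bij_betw_apply[OF P0 i], of "val A i" p] val_bounds[OF i] p bstar(2)[OF i]
    unfolding placed_expected[OF pl0 i] B1_def by (simp add: mult.commute)
  have base: "\<exists>P B. bij_betw P cols cols \<and> disc_ladder p B \<and>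
      (U - (\<Sum>i\<in>cols. t i)) + (\<Sum>i\<in>cols. a i * (t i - p)) \<le> score a P B"
    if a: "\<And>i. i \<in> cols \<Longrightarrow> 1 \<le> a i \<and> a i * val A i \<le> 1" for a
  proof -
    obtain b where b: "b \<in> cols \<rightarrow>\<^sub>E {0..1}"
      and le: "U + (\<Sum>i\<in>cols. (a i - 1) * t i)
        \<le> (\<Sum>i\<in>cols. a i * exp_revenue A i (plain b) - exp_payment mech A i (plain b))"
      using U[of a] a by blast
    obtain P B where pl: "placed A (plain b) P B" and P: "bij_betw P cols cols" and B: "ladder A B"
      using plain_placed[OF b] by blast
    define C where "C k = round_down A p (B k)" for k
    have each: "a i * exp_revenue A i (plain b) - exp_payment mech A i (plain b) - a i * p
        \<le> a i * val A i * clicks C (P i) - price C (P i)" if i: "i \<in> cols" for i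
    proof -
      have "a i * val A i * clicks B (P i) - price B (P i) - p \<le> a i * val A i * clicks C (P i) - price C (P i)"
        unfolding C_def using a[OF i] val_bounds[OF i] p
        by (intro round_down_loss[OF B bij_betw_apply[OF P i]]) auto
      \<comment> \<open>Rounding costs \<open>p\<close>, while the target leaves room for
        \<open>a i * p\<close>.\<close>
      moreover have "p \<le> a i * p" using mult_right_mono[of 1 "a i" p] a[OF i] p by simp
      ultimately show ?thesis
        unfolding placed_expected[OF pl i] by (simp add: mult.commute mult.left_commute)
    qed
    have "(\<Sum>i\<in>cols. a i * exp_revenue A i (plain b) - exp_payment mech A i (plain b) - a i * p) \<le> score a P C"
      unfolding score_def by (rule sum_mono) (rule each)
    then have "(U - (\<Sum>i\<in>cols. t i)) + (\<Sum>i\<in>cols. a i * (t i - p)) \<le> score a P C"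
      using le by (simp add: sum_subtractf sum.distrib algebra_simps)
    moreover have "disc_ladder p C" unfolding C_def by (rule disc_ladder_round_down[OF B])
    ultimately show ?thesis using P by blast
  qed
  have alt: "\<exists>b\<in>S. 0 \<le> (\<Sum>i\<in>insert 0 cols. \<mu> i * F b i)"
    if \<mu>: "\<And>i. i \<in> insert 0 cols \<Longrightarrow> 0 \<le> \<mu> i" "0 < \<mu> 0" for \<mu> :: "nat \<Rightarrow> real"
  proof -
    \<comment> \<open>The excess of \<open>a i\<close> over 1 is the multiplier of a revenue
      constraint relative to that of the objective.\<close>
    define a where "a i = 1 + \<mu> i / \<mu> 0" for i
    have a1: "1 \<le> a i" if "i \<in> cols" for i
      using \<mu> that by (simp add: a_def)
    have "\<exists>P B. bij_betw P cols cols \<and> disc_ladder p B \<and>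
        (U - (\<Sum>i\<in>cols. t i)) + (\<Sum>i\<in>cols. a i * (t i - p)) \<le> score a P B"
    proof (rule score_dual[OF _ P0 B1])
      show "\<exists>P B. bij_betw P cols cols \<and> disc_ladder p B \<and>
          (U - (\<Sum>i\<in>cols. t i)) + (\<Sum>i\<in>cols. a' i * (t i - p)) \<le> score a' P B"
        if "\<And>i. i \<in> cols \<Longrightarrow> 1 \<le> a' i \<and> a' i * val A i \<le> 1" for a'
        using that by (rule base)
    qed (rule c1 a1, assumption)+
    then obtain P B where P: "bij_betw P cols cols" and B: "disc_ladder p B"
      and le: "(U - (\<Sum>i\<in>cols. t i)) + (\<Sum>i\<in>cols. a i * (t i - p)) \<le> score a P B"
      by blast
    let ?b = "seq_strategy A P B"
    have pl: "placed A ?b P B"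
      using B by (intro placed_seq_strategy P) (simp add: disc_ladder_def)
    have sc: "score a P B = (\<Sum>i\<in>cols. a i * exp_revenue A i ?b - exp_payment mech A i ?b)"
      unfolding score_def using placed_expected[OF pl]
      by (intro sum.cong) (simp_all add: mult.commute mult.left_commute)
    have "(\<Sum>i\<in>insert 0 cols. \<mu> i * F ?b i) = \<mu> 0 * F ?b 0 + (\<Sum>i\<in>cols. \<mu> i * F ?b i)"
      by simp
    also have "(\<Sum>i\<in>cols. \<mu> i * F ?b i) = \<mu> 0 * (\<Sum>i\<in>cols. (a i - 1) * (exp_revenue A i ?b - (t i - p)))"
      unfolding sum_distrib_left using \<mu>(2) by (intro sum.cong) (auto simp: a_def F_def)
    also have "\<mu> 0 * F ?b 0 + \<mu> 0 * (\<Sum>i\<in>cols. (a i - 1) * (exp_revenue A i ?b - (t i - p)))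
      = \<mu> 0 * (score a P B - (U - (\<Sum>i\<in>cols. t i)) - (\<Sum>i\<in>cols. a i * (t i - p)))"
      unfolding sc F_def util_def by (simp add: sum_subtractf sum.distrib algebra_simps)
    finally have "0 \<le> (\<Sum>i\<in>insert 0 cols. \<mu> i * F ?b i)"
      using le \<mu>(2) by simp
    then show ?thesis
      using seq_strategy_disc[OF P B] unfolding S_def by blast
  qed
  have S: "finite S" "S \<noteq> {}"
    using finite_disc_strategies seq_strategy_disc[OF P0 B1] unfolding S_def by blast+
  have "\<exists>g. (\<forall>s. 0 \<le> g s) \<and> (\<forall>s. s \<notin> S \<longrightarrow> g s = 0) \<and> (\<Sum>s\<in>S. g s) = 1 \<and>
      (\<forall>i\<in>insert 0 cols. 0 \<le> (\<Sum>s\<in>S. g s * F s i))"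
  proof (rule convex_alternative_pos[OF S])
    show "\<exists>b\<in>S. 0 \<le> (\<Sum>i\<in>insert 0 cols. \<mu> i * F b i)"
      if "\<And>i. i \<in> insert 0 cols \<Longrightarrow> 0 \<le> \<mu> i" "0 < \<mu> 0" for \<mu> :: "nat \<Rightarrow> real"
      using that by (rule alt)
  qed simp_all
  then obtain g where g: "\<And>s. 0 \<le> g s" "\<And>s. s \<notin> S \<Longrightarrow> g s = 0" "(\<Sum>s\<in>S. g s) = 1"
    and gF: "\<And>i. i \<in> insert 0 cols \<Longrightarrow> 0 \<le> (\<Sum>s\<in>S. g s * F s i)"
    by blast
  obtain \<gamma> where \<gamma>: "set_pmf \<gamma> \<subseteq> S" "\<And>s. pmf \<gamma> s = g s"
    using pmf_of_weights[OF S(1) g] by blast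
  have "t i - p \<le> (\<Sum>b\<in>S. pmf \<gamma> b * exp_revenue A i b)" if i: "i \<in> cols" for i
  proof -
    have "0 \<le> (\<Sum>s\<in>S. g s * (exp_revenue A i s - (t i - p)))"
      using gF[of i] i by (simp add: F_def)
    also have "\<dots> = (\<Sum>s\<in>S. g s * exp_revenue A i s) - (\<Sum>s\<in>S. g s) * (t i - p)"
      unfolding sum_distrib_right sum_subtractf[symmetric] by (simp add: algebra_simps)
    finally show ?thesis using g(3) \<gamma>(2) by simp
  qed
  moreover have "U - p * real (n_col A) \<le> lp_objective mech A p \<gamma>"
  proof -
    have "0 \<le> (\<Sum>s\<in>S. g s * (util s - (U - p * real (n_col A))))"
      using gF[of 0] by (simp add: F_def)
    also have "\<dots> = (\<Sum>s\<in>S. g s * util s) - (\<Sum>s\<in>S. g s) * (U - p * real (n_col A))"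
      unfolding sum_distrib_right sum_subtractf[symmetric] by (simp add: algebra_simps)
    finally show ?thesis using g(3) \<gamma>(2) by (simp add: lp_objective_def S_def util_def)
  qed
  ultimately show ?thesis using \<gamma>(1) unfolding S_def by blast
qed

lemma lp_feasible_of_mixture:
  fixes p :: real
  assumes "set_pmf \<gamma> \<subseteq> disc_strategies A p"
    and rev: "\<forall>i\<in>cols. t i - p \<le> (\<Sum>b\<in>disc_strategies A p. pmf \<gamma> b * exp_revenue A i b)"
    and obj: "(\<Sum>i\<in>cols. t i) - p * real (n_col A) \<le> lp_objective mech A p \<gamma>"
  shows "\<exists>q. lp_feasible mech A t p \<gamma> q"
proof -
  let ?S = "disc_strategies A p"
  \<comment> \<open>The largest transfers that the relaxed revenue constraints permit; the budget
    constraint then turns into the bound on the objective.\<close>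
  define q where "q i = (\<Sum>b\<in>?S. pmf \<gamma> b * exp_revenue A i b) - (t i - p)" for i
  have "(\<Sum>i\<in>cols. q i) = (\<Sum>i\<in>cols. \<Sum>b\<in>?S. pmf \<gamma> b * exp_revenue A i b) - (\<Sum>i\<in>cols. t i) + p * real (n_col A)"
    by (simp add: q_def sum_subtractf)
  also have "(\<Sum>i\<in>cols. \<Sum>b\<in>?S. pmf \<gamma> b * exp_revenue A i b)
      = (\<Sum>b\<in>?S. pmf \<gamma> b * (\<Sum>i\<in>cols. exp_revenue A i b))"
    by (subst sum.swap) (simp add: sum_distrib_left)
  also have "\<dots> = lp_objective mech A p \<gamma> + (\<Sum>b\<in>?S. pmf \<gamma> b * (\<Sum>i\<in>cols. exp_payment mech A i b))"
    by (simp add: lp_objective_def sum_subtractf right_diff_distrib)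
  finally have "(\<Sum>b\<in>?S. pmf \<gamma> b * (\<Sum>i\<in>cols. exp_payment mech A i b)) \<le> (\<Sum>i\<in>cols. q i)"
    using obj by linarith
  moreover have "0 \<le> q i" if "i \<in> cols" for i
    using rev that by (simp add: q_def)
  ultimately show ?thesis
    using assms(1) by (intro exI[of _ q]) (simp add: lp_feasible_def q_def)
qed

end

section \<open>Measurability in the colluders' bids\<close>

lemma (in prob_space) exists_ge_expectation:
  fixes f :: "'a \<Rightarrow> real"
  assumes "integrable M f"
  shows "\<exists>x\<in>space M. expectation f \<le> f x"
proof (rule ccontr)
  assume "\<not> ?thesis"
  then have "AE x in M. f x < expectation f" by (intro AE_I2) (auto simp: not_le)
  from expectation_less[OF assms this] show False by simp
qed

context ad_setting
begin

lemma space_bid_space: "space (bid_space A) = cols \<rightarrow>\<^sub>E {0..1}"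
  by (simp add: bid_space_def space_PiM space_restrict_space)

lemma measurable_bid:
  assumes "i \<in> cols"
  shows "(\<lambda>b. b i) \<in> borel_measurable (bid_space A)"
proof -
  have "(\<lambda>b. b i) \<in> measurable (bid_space A) (restrict_space borel {0..1})"
    unfolding bid_space_def by (rule measurable_component_singleton[OF assms])
  moreover have "(\<lambda>x :: real. x) \<in> borel_measurable (restrict_space borel {0..1})"
    by (rule measurable_restrict_space1) simp
  ultimately show ?thesis by (rule measurable_compose)
qed

lemma measurable_count:
  fixes Q :: "(nat \<Rightarrow> real) \<Rightarrow> nat \<Rightarrow> bool"
  assumes "\<And>j. j \<in> J \<Longrightarrow> {b \<in> space M. Q b j} \<in> sets M"
  shows "(\<lambda>b. card {j \<in> J. Q b j}) \<in> measurable M (count_space UNIV)"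
proof (rule measurable_card)
  fix j
  show "{b \<in> space M. j \<in> {j \<in> J. Q b j}} \<in> sets M"
    using assms[of j] by (cases "j \<in> J") simp_all
qed

lemma measurable_col_above: "(\<lambda>b. col_above A (plain b) x) \<in> measurable (bid_space A) (count_space UNIV)"
  unfolding col_above_def plain_def fst_conv
proof (rule measurable_count)
  fix i assume "i \<in> cols"
  note [measurable] = measurable_bid[OF this]
  show "{b \<in> space (bid_space A). x < b i} \<in> sets (bid_space A)" by measurable
qed

lemma measurable_rank:
  assumes i: "i \<in> cols"
  shows "(\<lambda>b. rank A (plain b) be (Colluder i)) \<in> measurable (bid_space A) (count_space UNIV)"
proof -
  have c: "(\<lambda>b. card {i' \<in> cols. b i < b i' \<or> b i' = b i \<and> i' < i}) \<in> measurable (bid_space A) (count_space UNIV)"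
  proof (rule measurable_count)
    fix i' assume i': "i' \<in> cols"
    have "{b \<in> space (bid_space A). b i < b i' \<or> b i' = b i \<and> i' < i} =
        (if i' < i then {b \<in> space (bid_space A). b i \<le> b i'} else {b \<in> space (bid_space A). b i < b i'})"
      by auto
    then show "{b \<in> space (bid_space A). b i < b i' \<or> b i' = b i \<and> i' < i} \<in> sets (bid_space A)"
      using borel_measurable_le[OF measurable_bid[OF i] measurable_bid[OF i']]
        borel_measurable_less[OF measurable_bid[OF i] measurable_bid[OF i']] by simp
  qed
  have "place A (plain b) i = Suc (card {i' \<in> cols. b i < b i' \<or> b i' = b i \<and> i' < i})" for b
    by (simp add: place_def plain_def)
  then have p: "(\<lambda>b. place A (plain b) i) \<in> measurable (bid_space A) (count_space UNIV)"
    by (simp only: measurable_compose[OF c measurable_count_space])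
  have e: "(\<lambda>b. ext_above A be (fst (plain b i))) \<in> measurable (bid_space A) (count_space UNIV)"
    unfolding ext_above_def plain_def fst_conv
    by (rule measurable_count) (rule borel_measurable_less[OF measurable_bid[OF i] borel_measurable_const])
  show ?thesis
    unfolding rank_Colluder
    by (rule measurable_compose_countable[OF measurable_compose[OF e measurable_count_space] p])
qed

text \<open>Its superlevel sets are given by counts of colluders' bids, so the sorted list need not
  be analysed.\<close>

lemma measurable_kth_bid: "(\<lambda>b. kth_bid A (plain b) be k) \<in> borel_measurable (bid_space A)"
proof (cases "1 \<le> k \<and> k \<le> n_col A + n_ext A")
  case False
  show ?thesis unfolding kth_bid_def if_not_P[OF False] by simp
next
  case True
  show ?thesis
    unfolding borel_measurable_iff_greater
  proof
    fix x
    note [measurable] = measurable_col_above[of x]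
    have "{b \<in> space (bid_space A). k \<le> col_above A (plain b) x + ext_above A be x} \<in> sets (bid_space A)"
      by measurable
    then show "{b \<in> space (bid_space A). x < kth_bid A (plain b) be k} \<in> sets (bid_space A)"
      using True by (simp add: kth_bid_gt_iff)
  qed
qed

lemma measurable_revenue:
  assumes "i \<in> cols"
  shows "(\<lambda>b. revenue A (plain b) be i) \<in> borel_measurable (bid_space A)"
  unfolding revenue_def
  by (rule measurable_compose[OF measurable_rank[OF assms]]) simp

lemma measurable_payment:
  assumes "i \<in> cols"
  shows "(\<lambda>b. payment mech A (plain b) be i) \<in> borel_measurable (bid_space A)"
proof -
  \<comment> \<open>\<open>f k\<close> freezes the rank at \<open>k\<close>; ranks are countably
    many, so measurability for each fixed \<open>k\<close> suffices.\<close>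
  define f where "f k b = (case mech of GSP \<Rightarrow> ctr A k * kth_bid A (plain b) be (k + 1)
    | VCG \<Rightarrow> if k \<le> n_slots A
      then \<Sum>j = k + 1..n_slots A + 1. kth_bid A (plain b) be j * (ctr A (j - 1) - ctr A j)
      else 0)" for k b
  have "f k \<in> borel_measurable (bid_space A)" for k
  proof (cases "mech = GSP")
    case True
    then have "f k = (\<lambda>b. ctr A k * kth_bid A (plain b) be (k + 1))"
      unfolding f_def by simp
    then show ?thesis
      by (simp only:) (intro borel_measurable_times borel_measurable_const measurable_kth_bid)
  next
    case False
    then have "mech = VCG" by (cases mech) simp_all
    then have "f k = (\<lambda>b. if k \<le> n_slots A
        then \<Sum>j = k + 1..n_slots A + 1. kth_bid A (plain b) be j * (ctr A (j - 1) - ctr A j) else 0)"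
      unfolding f_def by simp
    then show ?thesis
      by (simp only:, cases "k \<le> n_slots A"; simp only: if_True if_False)
         (intro borel_measurable_sum borel_measurable_times borel_measurable_const measurable_kth_bid)+
  qed
  from measurable_compose_countable[OF this measurable_rank[OF assms]]
  have "(\<lambda>b. f (rank A (plain b) be (Colluder i)) b) \<in> borel_measurable (bid_space A)" .
  moreover have "payment mech A (plain b) be i = f (rank A (plain b) be (Colluder i)) b" for b
    unfolding f_def by (cases mech rule: mechanism.exhaust) (simp_all add: Let_def)
  ultimately show ?thesis by simp
qed

lemma expectation_sum:
  fixes f :: "(nat \<Rightarrow> real) \<Rightarrow> real"
  shows "measure_pmf.expectation (ext_dist A) f = (\<Sum>be\<in>ext_profiles A. pmf (ext_dist A) be * f be)"
  using integral_measure_pmf[OF finite_ext_profiles, of "ext_dist A" f] ext_dist_profiles by auto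

lemma measurable_expected:
  assumes "i \<in> cols"
  shows "(\<lambda>b. exp_revenue A i (plain b)) \<in> borel_measurable (bid_space A)"
    and "(\<lambda>b. exp_payment mech A i (plain b)) \<in> borel_measurable (bid_space A)"
proof -
  show "(\<lambda>b. exp_revenue A i (plain b)) \<in> borel_measurable (bid_space A)"
    unfolding exp_revenue_def expectation_sum
    by (intro borel_measurable_sum borel_measurable_times borel_measurable_const measurable_revenue[OF assms])
  show "(\<lambda>b. exp_payment mech A i (plain b)) \<in> borel_measurable (bid_space A)"
    unfolding exp_payment_def expectation_sum
    by (intro borel_measurable_sum borel_measurable_times borel_measurable_const measurable_payment[OF assms])
qed

lemma price_le_clicks: "1 \<le> k \<Longrightarrow> price B k \<le> clicks B k"
  unfolding price_def clicks_def by (intro expectation_mono seq_pay_bounds)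

lemma expected_bounds:
  assumes "b \<in> cols \<rightarrow>\<^sub>E {0..1}" "i \<in> cols"
  shows "\<bar>exp_revenue A i (plain b)\<bar> \<le> 1" "\<bar>exp_payment mech A i (plain b)\<bar> \<le> 1"
proof -
  obtain P B where pl: "placed A (plain b) P B" and P: "bij_betw P cols cols"
    using plain_placed[OF assms(1)] by blast
  have k: "1 \<le> P i" using bij_betw_apply[OF P assms(2)] by simp
  show "\<bar>exp_revenue A i (plain b)\<bar> \<le> 1"
    unfolding placed_expected(2)[OF pl assms(2)]
    using clicks_bounds[OF k, of B] val_bounds[OF assms(2)] by (simp add: abs_mult mult_le_one)
  show "\<bar>exp_payment mech A i (plain b)\<bar> \<le> 1"
    unfolding placed_expected(1)[OF pl assms(2)]
    using clicks_bounds[OF k, of B] price_le_clicks[OF k, of B] price_nonneg[OF k, of B] by linarith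
qed

text \<open>Needed because the Bochner integral is 0 by convention, and not linear, outside the
  integrable functions.\<close>

lemma integrable_expected:
  assumes \<gamma>: "prob_space \<gamma>" "sets \<gamma> = sets (bid_space A)" and i: "i \<in> cols"
  shows "integrable \<gamma> (\<lambda>b. exp_revenue A i (plain b))"
    and "integrable \<gamma> (\<lambda>b. exp_payment mech A i (plain b))"
proof -
  interpret prob_space \<gamma> by fact
  have sp: "space \<gamma> = cols \<rightarrow>\<^sub>E {0..1}"
    using sets_eq_imp_space_eq[OF \<gamma>(2)] by (simp add: space_bid_space)
  have meas: "f \<in> borel_measurable (bid_space A) \<Longrightarrow> f \<in> borel_measurable \<gamma>" for f :: "_ \<Rightarrow> real"
    by (simp only: measurable_cong_sets[OF \<gamma>(2) refl])
  show "integrable \<gamma> (\<lambda>b. exp_revenue A i (plain b))"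
    by (rule integrable_const_bound[of _ 1]) (use expected_bounds(1)[OF _ i] meas[OF measurable_expected(1)[OF i]] in \<open>auto simp: sp\<close>)
  show "integrable \<gamma> (\<lambda>b. exp_payment mech A i (plain b))"
    by (rule integrable_const_bound[of _ 1]) (use expected_bounds(2)[OF _ i] meas[OF measurable_expected(2)[OF i]] in \<open>auto simp: sp\<close>)
qed

end

theorem lemma7:
  fixes mech :: mechanism and A :: auction and t :: "nat \<Rightarrow> real" and p :: real
  assumes "ad_auction A"
    and "\<forall>i\<in>{1..n_col A}. 0 \<le> t i \<and> t i \<le> 1"
    and "\<exists>b \<in> {1..n_col A} \<rightarrow>\<^sub>E {0..1}.
           \<forall>i\<in>{1..n_col A}. exp_revenue A i (plain b) - exp_payment mech A i (plain b) \<ge> t i"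
    and "0 < p" and "p \<le> 1"
  shows "(\<exists>\<gamma> q. lp_feasible mech A t p \<gamma> q) \<and>
         lp_opt mech A t p \<ge> ma_opt mech A t - ereal (p * real (n_col A))"
proof
  interpret ad_setting A mech by unfold_locales fact
  obtain bstar where bstar: "bstar \<in> cols \<rightarrow>\<^sub>E {0..1}"
    and tstar: "\<And>i. i \<in> cols \<Longrightarrow> t i \<le> exp_revenue A i (plain bstar) - exp_payment mech A i (plain bstar)"
    using assms(3) by blast
  have p: "0 \<le> p" using assms(4) by simp
  \<comment> \<open>Used twice: with \<open>U\<close> the sum of the \<open>t i\<close>, witnessed
    by \<open>bstar\<close>, for feasibility, and with \<open>U\<close> the objective of an
    arbitrary feasible \<open>\<gamma>\<close> for the bound. Condition \<open>tU\<close> is what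
    finances the transfers.\<close>
  have mixture: "\<exists>\<gamma> q. lp_feasible mech A t p \<gamma> q \<and> U - p * real (n_col A) \<le> lp_objective mech A p \<gamma>"
    if U: "\<And>a. (\<And>i. i \<in> cols \<Longrightarrow> 1 \<le> a i) \<Longrightarrow> \<exists>b \<in> cols \<rightarrow>\<^sub>E {0..1}. U + (\<Sum>i\<in>cols. (a i - 1) * t i)
        \<le> (\<Sum>i\<in>cols. a i * exp_revenue A i (plain b) - exp_payment mech A i (plain b))"
      and tU: "(\<Sum>i\<in>cols. t i) \<le> U" for U
  proof -
    have "\<exists>\<gamma>. set_pmf \<gamma> \<subseteq> disc_strategies A p \<and>
        (\<forall>i\<in>cols. t i - p \<le> (\<Sum>b\<in>disc_strategies A p. pmf \<gamma> b * exp_revenue A i b)) \<and>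
        U - p * real (n_col A) \<le> lp_objective mech A p \<gamma>"
      using p bstar tstar U by (rule disc_mixture)
    then obtain \<gamma> where \<gamma>: "set_pmf \<gamma> \<subseteq> disc_strategies A p"
      "\<forall>i\<in>cols. t i - p \<le> (\<Sum>b\<in>disc_strategies A p. pmf \<gamma> b * exp_revenue A i b)"
      "U - p * real (n_col A) \<le> lp_objective mech A p \<gamma>"
      by blast
    have "(\<Sum>i\<in>cols. t i) - p * real (n_col A) \<le> lp_objective mech A p \<gamma>"
      using \<gamma>(3) tU by linarith
    from lp_feasible_of_mixture[OF \<gamma>(1,2) this] \<gamma>(3) show ?thesis by blast
  qed
  show "\<exists>\<gamma> q. lp_feasible mech A t p \<gamma> q"
  proof -
    have "(\<Sum>i\<in>cols. t i) + (\<Sum>i\<in>cols. (a i - 1) * t i)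
        \<le> (\<Sum>i\<in>cols. a i * exp_revenue A i (plain bstar) - exp_payment mech A i (plain bstar))"
      if a: "\<And>i. i \<in> cols \<Longrightarrow> 1 \<le> a i" for a
      unfolding sum.distrib[symmetric]
    proof (rule sum_mono)
      fix i assume i: "i \<in> cols"
      \<comment> \<open>Payments are nonnegative, so the assumed utility bound also bounds the
        revenue.\<close>
      have "(a i - 1) * t i \<le> (a i - 1) * exp_revenue A i (plain bstar)"
        using a[OF i] tstar[OF i] exp_payment_nonneg[OF bstar i] by (intro mult_left_mono) auto
      then show "t i + (a i - 1) * t i
          \<le> a i * exp_revenue A i (plain bstar) - exp_payment mech A i (plain bstar)"
        using tstar[OF i] by (simp add: left_diff_distrib)
    qed
    then have *: "\<exists>b \<in> cols \<rightarrow>\<^sub>E {0..1}. (\<Sum>i\<in>cols. t i) + (\<Sum>i\<in>cols. (a i - 1) * t i)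
        \<le> (\<Sum>i\<in>cols. a i * exp_revenue A i (plain b) - exp_payment mech A i (plain b))"
      if "\<And>i. i \<in> cols \<Longrightarrow> 1 \<le> a i" for a
      using bstar that by blast
    have "\<exists>\<gamma> q. lp_feasible mech A t p \<gamma> q \<and>
        (\<Sum>i\<in>cols. t i) - p * real (n_col A) \<le> lp_objective mech A p \<gamma>"
      by (rule mixture) (rule *, assumption, rule order_refl)
    then show ?thesis by blast
  qed
  \<comment> \<open>Comparing with each feasible point suffices, so no supremum has to be
    attained.\<close>
  have "ereal (ma_objective mech A \<gamma>) \<le> lp_opt mech A t p + ereal (p * real (n_col A))"
    if feas: "ma_feasible mech A t \<gamma> q" for \<gamma> q
  proof -
    have \<gamma>: "prob_space \<gamma>" "sets \<gamma> = sets (bid_space A)"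
      and IC: "\<And>i. i \<in> cols \<Longrightarrow> t i \<le> (LINT b|\<gamma>. exp_revenue A i (plain b)) - q i"
      and IR: "(\<Sum>i\<in>cols. LINT b|\<gamma>. exp_payment mech A i (plain b)) \<le> (\<Sum>i\<in>cols. q i)"
      and LL: "\<And>i. i \<in> cols \<Longrightarrow> 0 \<le> q i"
      using feas by (auto simp: ma_feasible_def)
    interpret \<gamma>: prob_space \<gamma> by fact
    have sp: "space \<gamma> = cols \<rightarrow>\<^sub>E {0..1}"
      using sets_eq_imp_space_eq[OF \<gamma>(2)] by (simp add: space_bid_space)
    define r where "r i = (LINT b|\<gamma>. exp_revenue A i (plain b))" for i
    define \<pi> where "\<pi> i = (LINT b|\<gamma>. exp_payment mech A i (plain b))" for i
    note int = integrable_expected[OF \<gamma>]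
    have obj: "ma_objective mech A \<gamma> = (\<Sum>i\<in>cols. r i - \<pi> i)"
      unfolding ma_objective_def r_def \<pi>_def by (intro sum.cong refl Bochner_Integration.integral_diff int)
    have tr: "t i \<le> r i" if "i \<in> cols" for i
      using IC[OF that] LL[OF that] by (simp add: r_def)
    \<comment> \<open>Summing IC and using IR cancels the transfers.\<close>
    have "(\<Sum>i\<in>cols. t i + q i) \<le> (\<Sum>i\<in>cols. r i)"
      using IC by (intro sum_mono) (fastforce simp: r_def)
    then have tU: "(\<Sum>i\<in>cols. t i) \<le> ma_objective mech A \<gamma>"
      using IR unfolding obj by (simp add: sum.distrib sum_subtractf \<pi>_def)
    have *: "\<exists>b \<in> cols \<rightarrow>\<^sub>E {0..1}. ma_objective mech A \<gamma> + (\<Sum>i\<in>cols. (a i - 1) * t i)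
        \<le> (\<Sum>i\<in>cols. a i * exp_revenue A i (plain b) - exp_payment mech A i (plain b))"
      if a: "\<And>i. i \<in> cols \<Longrightarrow> 1 \<le> a i" for a
    proof -
      let ?f = "\<lambda>b. \<Sum>i\<in>cols. a i * exp_revenue A i (plain b) - exp_payment mech A i (plain b)"
      have "integrable \<gamma> ?f"
        by (intro Bochner_Integration.integrable_sum Bochner_Integration.integrable_diff integrable_mult_right int)
      \<comment> \<open>Some pure strategy is at least as good as the average, whose weighted value
        is the objective plus the weighted revenues, each at least \<open>t i\<close>.\<close>
      from \<gamma>.exists_ge_expectation[OF this] obtain b where b: "b \<in> cols \<rightarrow>\<^sub>E {0..1}" "\<gamma>.expectation ?f \<le> ?f b"
        unfolding sp by blast
      have "\<gamma>.expectation ?f = (\<Sum>i\<in>cols. LINT b|\<gamma>. a i * exp_revenue A i (plain b) - exp_payment mech A i (plain b))"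
        by (intro Bochner_Integration.integral_sum Bochner_Integration.integrable_diff integrable_mult_right int)
      also have "\<dots> = (\<Sum>i\<in>cols. a i * r i - \<pi> i)"
      proof (rule sum.cong[OF refl])
        fix i assume i: "i \<in> cols"
        show "(LINT b|\<gamma>. a i * exp_revenue A i (plain b) - exp_payment mech A i (plain b)) = a i * r i - \<pi> i"
          unfolding r_def \<pi>_def using int(1)[OF i] int(2)[OF i] by simp
      qed
      also have "\<dots> = ma_objective mech A \<gamma> + (\<Sum>i\<in>cols. (a i - 1) * r i)"
        unfolding obj sum.distrib[symmetric] by (simp add: algebra_simps)
      finally have "\<gamma>.expectation ?f = ma_objective mech A \<gamma> + (\<Sum>i\<in>cols. (a i - 1) * r i)" .
      moreover have "(\<Sum>i\<in>cols. (a i - 1) * t i) \<le> (\<Sum>i\<in>cols. (a i - 1) * r i)"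
        using a tr by (intro sum_mono mult_left_mono) auto
      ultimately show ?thesis using b by (intro bexI[of _ b]) auto
    qed
    have "\<exists>\<gamma>' q'. lp_feasible mech A t p \<gamma>' q' \<and>
        ma_objective mech A \<gamma> - p * real (n_col A) \<le> lp_objective mech A p \<gamma>'"
      by (rule mixture) (rule *, assumption, rule tU)
    then obtain \<gamma>' q' where "lp_feasible mech A t p \<gamma>' q'"
      and le: "ma_objective mech A \<gamma> - p * real (n_col A) \<le> lp_objective mech A p \<gamma>'"
      by blast
    then have "ereal (lp_objective mech A p \<gamma>') \<le> lp_opt mech A t p"
      unfolding lp_opt_def by (intro SUP_upper2[of "(\<gamma>', q')"]) auto
    moreover have "ereal (ma_objective mech A \<gamma>)
        \<le> ereal (lp_objective mech A p \<gamma>') + ereal (p * real (n_col A))"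
      using le by simp
    ultimately show ?thesis by (meson add_right_mono order_trans)
  qed
  then have "ma_opt mech A t \<le> lp_opt mech A t p + ereal (p * real (n_col A))"
    unfolding ma_opt_def by (intro SUP_least) auto
  then show "ma_opt mech A t - ereal (p * real (n_col A)) \<le> lp_opt mech A t p"
    by (simp add: ereal_minus_le_iff add.commute)
qed

end
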